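(* Let $r, s \ge 1$ be fixed integers. Then $\hat{r}_s\big(P_n^{(r)}\big) = O(n)$; that is, there is a constant $C = C(r,s)$ such that $\hat{r}_s\big(P_n^{(r)}\big) \le C n$ for every positive integer $n$.
   Context: For hypergraphs $\mathcal{G}, \mathcal{H}$ and an integer $s$, write $\mathcal{G} \stackrel{s}{\longrightarrow} \mathcal{H}$ if every colouring of the edges of $\mathcal{G}$ with $s$ colours contains a monochromatic copy of $\mathcal{H}$ (a subhypergraph isomorphic to $\mathcal{H}$ all of whose edges have the same colour). The $s$-colour size-Ramsey number of $\mathcal{H}$ is $\hat{r}_s(\mathcal{H}) = \min\{e(\mathcal{G}) : \mathcal{G} \stackrel{s}{\longrightarrow} \mathcal{H}\}$, where $e(\mathcal{G})$ is the number of edges of $\mathcal{G}$. The $r$-uniform tight path on $n$ vertices, denoted $P_n^{(r)}$, is the $r$-uniform hypergraph with vertex set $[n]=\{1,\dots,n\}$ whose edges are all sets of $r$ consecutive elements of $[n]$. *)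

theory Defs
  imports Main "HOL-Library.Extended_Nat"
begin

record 'a hypergraph =
  verts :: "'a set"
  edges :: "'a set set"

definition finite_hypergraph :: "'a hypergraph \<Rightarrow> bool" where
  "finite_hypergraph G \<longleftrightarrow> finite (verts G) \<and> edges G \<subseteq> Pow (verts G)"

definition subhypergraph :: "'a hypergraph \<Rightarrow> 'a hypergraph \<Rightarrow> bool" where
  "subhypergraph H G \<longleftrightarrow>
     verts H \<subseteq> verts G \<and> edges H \<subseteq> edges G \<and> edges H \<subseteq> Pow (verts H)"

definition hypergraph_iso :: "'a hypergraph \<Rightarrow> 'b hypergraph \<Rightarrow> bool" where
  "hypergraph_iso G H \<longleftrightarrow>
     (\<exists>f. bij_betw f (verts G) (verts H) \<and> edges H = (\<lambda>e. f ` e) ` edges G)"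

definition monochromatic_copy ::
    "('a set \<Rightarrow> 'c) \<Rightarrow> 'a hypergraph \<Rightarrow> 'b hypergraph \<Rightarrow> bool" where
  "monochromatic_copy c G H \<longleftrightarrow>
     (\<exists>H'. subhypergraph H' G \<and> hypergraph_iso H H' \<and> (\<exists>k. \<forall>e\<in>edges H'. c e = k))"

definition arrows :: "'a hypergraph \<Rightarrow> nat \<Rightarrow> 'b hypergraph \<Rightarrow> bool" where
  "arrows G s H \<longleftrightarrow>
     (\<forall>c :: 'a set \<Rightarrow> nat. c ` edges G \<subseteq> {..<s} \<longrightarrow> monochromatic_copy c G H)"

text \<open>
  Host hypergraphs are taken on vertex sets of natural numbers; every finite hypergraph is
  isomorphic to one of these. The infimum is over \<^typ>\<open>enat\<close>, so it is the minimum if some finite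
  host exists and \<open>\<infinity>\<close> otherwise: a finite upper bound therefore entails that a host exists.
\<close>

definition size_ramsey :: "nat \<Rightarrow> 'b hypergraph \<Rightarrow> enat" where
  "size_ramsey s H =
     Inf {enat (card (edges G)) | G :: nat hypergraph. finite_hypergraph G \<and> arrows G s H}"

definition tight_path :: "nat \<Rightarrow> nat \<Rightarrow> nat hypergraph" where
  "tight_path r n =
     \<lparr>verts = {1..n}, edges = {e. e \<subseteq> {1..n} \<and> (\<exists>i. e = {i..<i + r})}\<rparr>"

end

theory Submission
  imports
    Defs
    Complex_Main
    "HOL-Library.Disjoint_Sets"
    "HOL-Library.FuncSet"
    "HOL-Library.Multiset"
    "HOL-Library.Nat_Bijection"
    "HOL-Library.Ramsey"
begin

text \<open>
  The host is a blow-up of a sparse expanding digraph \<open>F\<close> on \<open>O(n)\<close> vertices: every vertex is replaced by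
  \<open>K\<close> copies, and the edges are the \<open>r\<close>-sets inside the blow-ups of balls of bounded radius. By Ramsey's
  theorem one can pass to \<open>m\<close> copies of each vertex such that the colour of an edge depends only on the
  multiset of vertices of \<open>F\<close> below it. It then suffices to find in \<open>F\<close> a sequence of at least \<open>n\<close>
  vertices, all of whose \<open>r\<close>-windows have the same colour, and which visits each vertex at most \<open>m\<close> times.

  Attach to vertices \<open>u\<close> gadgets \<open>g u\<close>, lists of \<open>r\<close> vertices near \<open>u\<close>, and link \<open>u\<close> to \<open>v\<close> if for some
  list \<open>U\<close> of \<open>r\<close> vertices all windows of \<open>g u U g v\<close> have the same colour. A path of length \<open>n\<close> in the
  link graph yields the required sequence. If there is none, depth-first search gives large sets
  \<open>V_1, ..., V_B\<close> without links between them, and by expansion most vertices have an out-neighbour in each.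
  Iterating this with the gadgets supplied by the previous levels produces a tree of bounded height in
  which gadgets in sibling subtrees are never linked. A spine of that tree contains \<open>2 r\<close> vertices spanning
  a monochromatic clique; if the branching \<open>B\<close> exceeds the number of possible positions and colours of
  such cliques, two spines differing in one step have equal clique positions and colours, with
  that step in the middle, and this is a link between siblings.
\<close>

subsection \<open>Sparse expanding digraphs\<close>

text \<open>Markov's inequality for fibres; below it bounds the number of vertices of large
  in-degree.\<close>

lemma card_heavy_fibres:
  fixes h :: "'a \<Rightarrow> 'b"
  assumes "finite A" and "finite Z" and "h ` A \<subseteq> Z"
  shows "k * card {y \<in> Z. k \<le> card {x \<in> A. h x = y}} \<le> card A"
proof -
  let ?Y = "{y \<in> Z. k \<le> card {x \<in> A. h x = y}}"
  have "k * card ?Y \<le> (\<Sum>y\<in>?Y. card {x \<in> A. h x = y})"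
    using sum_bounded_below[of ?Y k "\<lambda>y. card {x \<in> A. h x = y}"] by (simp add: mult.commute)
  also have "\<dots> \<le> (\<Sum>y\<in>Z. card {x \<in> A. h x = y})"
    by (rule sum_mono2) (use assms in auto)
  also have "\<dots> = card (\<Union>y\<in>Z. {x \<in> A. h x = y})"
    by (rule card_UN_disjoint[symmetric]) (use assms in auto)
  also have "\<dots> \<le> card A"
    by (rule card_mono) (use assms in auto)
  finally show ?thesis .
qed

text \<open>\<open>((b - 1) / b) ^ D\<close> tends to 0, so a large out-degree \<open>D\<close>
  beats any constant factor in the union bound.\<close>

lemma power_gap:
  fixes c :: nat
  assumes "b \<ge> 1"
  shows "\<exists>D. c * (b - 1) ^ D < b ^ D"
proof (cases "b = 1")
  case True
  then show ?thesis by (intro exI[of _ 1]) auto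
next
  case False
  then have b: "real b > 1" using assms by auto
  have "(real b - 1) / real b < 1" "0 \<le> (real b - 1) / real b" using b by auto
  then have "(\<lambda>D. real c * ((real b - 1) / real b) ^ D) \<longlonglongrightarrow> real c * 0"
    by (intro tendsto_intros LIMSEQ_realpow_zero) auto
  then have "\<forall>\<^sub>F D in sequentially. real c * ((real b - 1) / real b) ^ D < 1"
    by (rule order_tendstoD) simp
  then obtain D where "real c * ((real b - 1) / real b) ^ D < 1"
    by (auto simp: eventually_sequentially)
  then have "real c * (real b - 1) ^ D < real b ^ D"
    using b by (simp add: power_divide divide_simps)
  then have "real (c * (b - 1) ^ D) < real (b ^ D)"
    using assms by (simp add: of_nat_diff)
  then show ?thesis by (metis of_nat_less_iff)
qed

text \<open>The values of \<open>f\<close> are chosen independently: each of the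
  \<open>D * card X\<close> arguments over \<open>X\<close> has to avoid \<open>Y\<close>, the
  others are free.\<close>

lemma card_functions_avoiding:
  assumes "finite Z" and "X \<subseteq> Z" and "Y \<subseteq> Z"
  shows "card {f \<in> Z \<times> {..<D} \<rightarrow>\<^sub>E Z. \<forall>x\<in>X. \<forall>i<D. f (x, i) \<notin> Y}
    = (card Z - card Y) ^ (D * card X) * card Z ^ (D * (card Z - card X))"
proof -
  have "{f \<in> Z \<times> {..<D} \<rightarrow>\<^sub>E Z. \<forall>x\<in>X. \<forall>i<D. f (x, i) \<notin> Y}
    = (\<Pi>\<^sub>E p\<in>Z \<times> {..<D}. if fst p \<in> X then Z - Y else Z)" (is "?L = ?R")
  proof
    show "?L \<subseteq> ?R"
      by (auto simp: PiE_iff extensional_def)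
    show "?R \<subseteq> ?L"
      using assms by (fastforce simp: PiE_iff split: if_splits)
  qed
  then have "card ?L = (\<Prod>p\<in>Z \<times> {..<D}. card (if fst p \<in> X then Z - Y else Z))"
    using assms by (simp add: card_PiE)
  also have "\<dots> = (\<Prod>x\<in>Z. \<Prod>i<D. card (if x \<in> X then Z - Y else Z))"
    by (simp only: prod.cartesian_product case_prod_unfold)
  also have "\<dots> = (\<Prod>x\<in>Z. (if x \<in> X then (card Z - card Y) ^ D else card Z ^ D))"
    using assms by (intro prod.cong) (auto simp: card_Diff_subset finite_subset)
  also have "\<dots> = ((card Z - card Y) ^ D) ^ card X * (card Z ^ D) ^ (card Z - card X)"
  proof -
    have "Z \<inter> {x. x \<in> X} = X" "Z \<inter> - {x. x \<in> X} = Z - X" using assms by auto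
    then show ?thesis
      using assms by (simp add: prod.If_cases card_Diff_subset finite_subset)
  qed
  finally show ?thesis by (simp add: power_mult)
qed

text \<open>Counting form of the random construction. Choose \<open>D\<close> out-neighbours for
  each of \<open>2 * a * n\<close> vertices; by the union bound some choice has an edge from
  \<open>X\<close> to \<open>Y\<close> for every pair of \<open>n\<close>-sets. The average
  in-degree is \<open>D\<close>, so at least half of the vertices have in-degree at most
  \<open>2 * D\<close>, and expansion passes to any subset of them.\<close>

lemma sparse_expander_exists:
  fixes a :: nat
  assumes "a \<ge> 1"
  shows "\<exists>\<Delta>. \<forall>n\<ge>1. \<exists>(V :: nat set) nb. finite V \<and> card V = a * n \<and>
    (\<forall>x\<in>V. nb x \<subseteq> V \<and> card (nb x) \<le> \<Delta> \<and> card {z \<in> V. x \<in> nb z} \<le> \<Delta>) \<and>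
    (\<forall>X Y. X \<subseteq> V \<longrightarrow> Y \<subseteq> V \<longrightarrow> n \<le> card X \<longrightarrow> n \<le> card Y \<longrightarrow> (\<exists>x\<in>X. nb x \<inter> Y \<noteq> {}))"
proof -
  \<comment> \<open>Among \<open>2 * a * n\<close> vertices there are at most
    \<open>4 ^ (2 * a * n)\<close> pairs of \<open>n\<close>-sets, and each is bad for a fraction
    \<open>((2 * a - 1) / (2 * a)) ^ (D * n)\<close> of the choices; \<open>D\<close> makes the
    product less than 1.\<close>
  obtain D where D: "4 ^ (2 * a) * (2 * a - 1) ^ D < (2 * a) ^ D"
    using power_gap[of "2 * a" "4 ^ (2 * a)"] assms by auto
  show ?thesis
  proof (intro exI[of _ "2 * D"] allI impI)
    fix n :: nat
    assume n: "n \<ge> 1"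
    define Z :: "nat set" where "Z = {..<2 * a * n}"
    have Z: "finite Z" "card Z = 2 * a * n" by (auto simp: Z_def)
    define F where "F = (Z \<times> {..<D} \<rightarrow>\<^sub>E Z)"
    define Q where "Q = {X. X \<subseteq> Z \<and> card X = n}"
    define bad where "bad = (\<lambda>(X, Y). {f \<in> F. \<forall>x\<in>X. \<forall>i<D. f (x, i) \<notin> Y})"
    have finQ: "finite Q" and cardQ: "card Q \<le> 2 ^ (2 * a * n)"
      using Z card_mono[of "Pow Z" Q] by (auto simp: Q_def card_Pow)
    have finF: "finite F" unfolding F_def using Z by (intro finite_PiE) auto
    have cardF: "card F = card Z ^ (D * card Z)"
      using Z by (simp add: F_def card_PiE card_cartesian_product mult.commute)
    let ?b = "(card Z - n) ^ (D * n) * card Z ^ (D * (card Z - n))"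
    have "card (\<Union>p\<in>Q \<times> Q. bad p) \<le> (\<Sum>p\<in>Q \<times> Q. card (bad p))"
      using finQ by (intro card_UN_le) auto
    also have "\<dots> = (\<Sum>p\<in>Q \<times> Q. ?b)"
      by (intro sum.cong refl)
        (auto simp: bad_def Q_def F_def card_functions_avoiding[OF Z(1)])
    also have "\<dots> = card Q * card Q * ?b"
      by (simp add: card_cartesian_product)
    also have "\<dots> \<le> 2 ^ (2 * a * n) * 2 ^ (2 * a * n) * ?b"
      using cardQ by (intro mult_mono) auto
    also have "\<dots> = (4 ^ (2 * a) * (2 * a - 1) ^ D) ^ n * n ^ (D * n) * card Z ^ (D * (card Z - n))"
    proof -
      have e: "card Z - n = (2 * a - 1) * n" using Z by (simp add: diff_mult_distrib)
      have "(2::nat) ^ (2 * a * n) * 2 ^ (2 * a * n) = (4 ^ (2 * a)) ^ n"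
        by (simp flip: power_mult_distrib power_mult)
      moreover have "((2 * a - 1) * n) ^ (D * n) = ((2 * a - 1) ^ D) ^ n * n ^ (D * n)"
        by (simp only: power_mult_distrib power_mult)
      ultimately show ?thesis
        unfolding e by (simp only: power_mult_distrib[of "4 ^ (2 * a)"] mult.assoc)
    qed
    also have "\<dots> < ((2 * a) ^ D) ^ n * n ^ (D * n) * card Z ^ (D * (card Z - n))"
      using D n assms Z by (intro mult_strict_right_mono power_strict_mono) auto
    also have "\<dots> = card Z ^ (D * n) * card Z ^ (D * (card Z - n))"
      using Z by (simp add: power_mult_distrib power_mult)
    also have "\<dots> = card Z ^ (D * card Z)"
      using Z assms by (simp add: power_add[symmetric] distrib_left[symmetric])
    finally have "card (\<Union>p\<in>Q \<times> Q. bad p) < card F" using cardF by simp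
    moreover have "(\<Union>p\<in>Q \<times> Q. bad p) \<subseteq> F" by (auto simp: bad_def)
    ultimately obtain f where f: "f \<in> F" "f \<notin> (\<Union>p\<in>Q \<times> Q. bad p)"
      by (metis less_irrefl subset_antisym subsetI)
    define indeg where "indeg y = card {p \<in> Z \<times> {..<D}. f p = y}" for y
    define L where "L = {y \<in> Z. indeg y \<le> 2 * D}"
    have "a * n \<le> card L"
    proof -
      have "(2 * D + 1) * card {y \<in> Z. 2 * D + 1 \<le> indeg y} \<le> card (Z \<times> {..<D})"
        unfolding indeg_def by (rule card_heavy_fibres) (use Z f in \<open>auto simp: F_def\<close>)
      also have "\<dots> = D * (2 * a * n)" using Z by (simp add: card_cartesian_product)
      finally have "(2 * D + 1) * card (Z - L) \<le> 2 * D * (a * n)"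
        by (simp add: L_def set_diff_eq Suc_le_eq not_le mult.assoc)
          (smt (verit) Collect_cong Suc_eq_plus1 mult.assoc mult.commute mult_Suc not_le)
      then have "(2 * D + 1) * card (Z - L) \<le> (2 * D + 1) * (a * n)"
        by (rule order_trans) simp
      then have "card (Z - L) \<le> a * n" by (simp del: mult_Suc)
      moreover have "card Z = card L + card (Z - L)"
        using Z card_mono[of Z L] by (simp add: L_def card_Diff_subset)
      ultimately show ?thesis using Z by simp
    qed
    then obtain V where V: "V \<subseteq> L" "card V = a * n" "finite V"
      by (meson obtain_subset_with_card_n)
    define nb where "nb x = f ` ({x} \<times> {..<D}) \<inter> V" for x
    have VZ: "V \<subseteq> Z" using V by (auto simp: L_def)
    show "\<exists>(V :: nat set) nb. finite V \<and> card V = a * n \<and>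
      (\<forall>x\<in>V. nb x \<subseteq> V \<and> card (nb x) \<le> 2 * D \<and> card {z \<in> V. x \<in> nb z} \<le> 2 * D) \<and>
      (\<forall>X Y. X \<subseteq> V \<longrightarrow> Y \<subseteq> V \<longrightarrow> n \<le> card X \<longrightarrow> n \<le> card Y \<longrightarrow> (\<exists>x\<in>X. nb x \<inter> Y \<noteq> {}))"
    proof (intro exI[of _ V] exI[of _ nb] conjI ballI allI impI)
      fix x assume x: "x \<in> V"
      have "card (nb x) \<le> card (f ` ({x} \<times> {..<D}))"
        unfolding nb_def by (intro card_mono) auto
      also have "\<dots> \<le> card ({x} \<times> {..<D})" by (intro card_image_le) auto
      finally show "card (nb x) \<le> 2 * D" by (simp add: card_cartesian_product)
      have "{z \<in> V. x \<in> nb z} \<subseteq> fst ` {p \<in> Z \<times> {..<D}. f p = x}"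
        using VZ by (force simp: nb_def)
      then have "card {z \<in> V. x \<in> nb z} \<le> indeg x"
        unfolding indeg_def using Z by (intro surj_card_le) auto
      then show "card {z \<in> V. x \<in> nb z} \<le> 2 * D" using x V by (auto simp: L_def)
    next
      fix X Y assume XY: "X \<subseteq> V" "Y \<subseteq> V" "n \<le> card X" "n \<le> card Y"
      obtain X' where X': "X' \<subseteq> X" "card X' = n" by (meson XY obtain_subset_with_card_n)
      obtain Y' where Y': "Y' \<subseteq> Y" "card Y' = n" by (meson XY obtain_subset_with_card_n)
      have "(X', Y') \<in> Q \<times> Q" using X' Y' XY VZ by (auto simp: Q_def)
      then have "f \<notin> bad (X', Y')" using f by blast
      then obtain x i where "x \<in> X'" "i < D" "f (x, i) \<in> Y'" using f by (auto simp: bad_def)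
      then show "\<exists>x\<in>X. nb x \<inter> Y \<noteq> {}"
        using X' Y' XY by (intro bexI[of _ x]) (force simp: nb_def)+
    qed (use V in \<open>auto simp: nb_def\<close>)
  qed
qed

subsection \<open>Depth-first search\<close>

text \<open>
  Depth-first search: \<open>S\<close> holds the finished, \<open>T\<close> the unvisited vertices and \<open>p\<close> the current
  path. The search is stopped when \<open>S\<close> first contains \<open>k\<close> vertices of \<open>U\<close> or of \<open>W\<close>.
\<close>

lemma no_long_path_imp_hole:
  fixes E :: "'a \<Rightarrow> 'a \<Rightarrow> bool"
  assumes fin: "finite U" "finite W" and disj: "U \<inter> W = {}"
    and large: "2 * k + n \<le> card U" "2 * k + n \<le> card W"
    and sym: "\<And>x y. E x y \<Longrightarrow> E y x"
    and no_path: "\<not> (\<exists>p. distinct p \<and> set p \<subseteq> U \<union> W \<and> length p = Suc n \<and> successively E p)"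
  shows "\<exists>U' W'. U' \<subseteq> U \<and> W' \<subseteq> W \<and> k \<le> card U' \<and> k \<le> card W' \<and> (\<forall>x\<in>U'. \<forall>y\<in>W'. \<not> E x y)"
proof -
  define state where "state S p T \<longleftrightarrow> S \<union> set p \<union> T = U \<union> W \<and> S \<inter> set p = {} \<and> S \<inter> T = {} \<and>
    set p \<inter> T = {} \<and> distinct p \<and> successively E p \<and> (\<forall>x\<in>S. \<forall>y\<in>T. \<not> E x y) \<and>
    card (S \<inter> U) \<le> k \<and> card (S \<inter> W) \<le> k" for S p T
  \<comment> \<open>The potential \<open>2 * card S + length p\<close> grows by one in each move: a
    push lengthens \<open>p\<close>, and finishing a vertex moves it from \<open>p\<close> to
    \<open>S\<close>. A state of maximal potential is therefore one where the search stops.\<close>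
  define reached where "reached m \<longleftrightarrow> (\<exists>S p T. state S p T \<and> m = 2 * card S + length p)" for m
  have fins: "finite S \<and> finite T" if "state S p T" for S p T
    using that fin unfolding state_def by (metis finite_Un)
  have short: "length p \<le> n" if st: "state S p T" for S p T
  proof (rule ccontr)
    assume "\<not> length p \<le> n"
    then have "length (take (Suc n) p) = Suc n" by simp
    moreover have "successively E (take (Suc n) p)"
      using st unfolding state_def by (metis append_take_drop_id successively_append_iff)
    moreover have "set (take (Suc n) p) \<subseteq> U \<union> W"
      using st set_take_subset[of "Suc n" p] unfolding state_def by blast
    ultimately show False using no_path st unfolding state_def by (meson distinct_take)
  qed
  have "state {} [] (U \<union> W)" by (simp add: state_def)
  then have "reached 0" by (force simp: reached_def)
  moreover have "m \<le> 2 * card (U \<union> W) + n" if m: "reached m" for m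
  proof -
    obtain S p T where st: "state S p T" "m = 2 * card S + length p"
      using m unfolding reached_def by blast
    have "card S \<le> card (U \<union> W)"
      using st fin by (intro card_mono) (auto simp: state_def)
    then show ?thesis using st short by fastforce
  qed
  ultimately obtain m where m: "reached m" "\<And>m'. reached m' \<Longrightarrow> m' \<le> m"
    using GreatestI_nat[of reached 0] Greatest_le_nat[of reached] by blast
  then obtain S p T where st: "state S p T" "m = 2 * card S + length p"
    by (auto simp: reached_def)
  note finS = fins[OF st(1), THEN conjunct1] and finT = fins[OF st(1), THEN conjunct2]
  \<comment> \<open>At most \<open>k\<close> vertices of a side are finished and at most
    \<open>n\<close> lie on the path, so at least \<open>k\<close> of its \<open>2 * k + n\<close>
    vertices are unvisited.\<close>
  have rest: "k \<le> card (T \<inter> X)" if X: "X = U \<or> X = W" for X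
  proof -
    have "card X \<le> card (S \<inter> X \<union> set p \<union> T \<inter> X)"
      using X st finS finT by (intro card_mono) (auto simp: state_def)
    also have "\<dots> \<le> card (S \<inter> X) + card (set p) + card (T \<inter> X)"
      by (meson add_mono_thms_linordered_semiring(3) card_Un_le le_trans)
    also have "\<dots> \<le> k + n + card (T \<inter> X)"
      using X st short[OF st(1)] card_length[of p] by (auto simp: state_def intro!: add_mono)
    finally show ?thesis using X large by auto
  qed
  show ?thesis
  proof (cases "card (S \<inter> U) = k \<or> card (S \<inter> W) = k")
    case True
    then show ?thesis
    proof
      assume "card (S \<inter> U) = k"
      then show ?thesis
        using rest[of W] st unfolding state_def
        by - (rule exI[of _ "S \<inter> U"], rule exI[of _ "T \<inter> W"], auto)
    next
      assume "card (S \<inter> W) = k"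
      then show ?thesis
        using rest[of U] st unfolding state_def
        by - (rule exI[of _ "T \<inter> U"], rule exI[of _ "S \<inter> W"], auto dest: sym)
    qed
  next
    case False
    then have lt: "card (S \<inter> U) < k" "card (S \<inter> W) < k" using st by (auto simp: state_def)
    then have "T \<noteq> {}" using rest[of U] by auto
    then obtain t0 where t0: "t0 \<in> T" by auto
    \<comment> \<open>Neither quota is filled, so one more move respects the bounds in
      \<open>state\<close> and contradicts the maximality of \<open>m\<close>. The current end of
      the path is \<open>hd p\<close>: it is extended if possible and otherwise finished.\<close>
    have False
    proof (cases "p = [] \<or> (\<exists>t\<in>T. E (hd p) t)")
      case True
      then obtain t where t: "t \<in> T" "p = [] \<or> E (hd p) t" using t0 by auto
      then have "state S (t # p) (T - {t})"
        using st sym by (auto simp: state_def successively_Cons)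
      then have "reached (2 * card S + length (t # p))" unfolding reached_def by blast
      then show False using m st by fastforce
    next
      case no_ext: False
      then obtain v q where p: "p = v # q" by (cases p) auto
      have le: "card (insert v S \<inter> X) \<le> Suc (card (S \<inter> X))" for X
        by (simp add: Int_insert_left card_insert_if finS)
      have "card (insert v S \<inter> U) \<le> k" "card (insert v S \<inter> W) \<le> k"
        using le[of U] le[of W] lt by auto
      then have "state (insert v S) q T"
        using st no_ext p by (auto simp: state_def successively_Cons)
      then have "reached (2 * card (insert v S) + length q)" unfolding reached_def by blast
      moreover have "card (insert v S) = Suc (card S)"
        using st finS p by (auto simp: state_def)
      ultimately show False using m(2) st p by fastforce
    qed
    then show ?thesis ..
  qed
qed

text \<open>The triples are treated one after another; a hole found between \<open>V a\<close> and
  \<open>V b\<close> persists in all smaller sets. Measured by \<open>card (V a) + n\<close>, each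
  application halves the size, which gives the factor \<open>2 ^ card \<T>\<close>.\<close>

lemma no_long_path_imp_simultaneous_holes:
  fixes E :: "'l \<Rightarrow> 'a \<Rightarrow> 'a \<Rightarrow> bool" and V :: "'b \<Rightarrow> 'a set"
  assumes "finite \<T>"
    and sym: "\<And>l x y. E l x y \<Longrightarrow> E l y x"
    and no_path: "\<And>l a b. (l, a, b) \<in> \<T> \<Longrightarrow>
      \<not> (\<exists>p. distinct p \<and> set p \<subseteq> A \<and> length p = Suc n \<and> successively (E l) p)"
    and "\<And>l a b. (l, a, b) \<in> \<T> \<Longrightarrow> a \<in> I \<and> b \<in> I \<and> a \<noteq> b"
    and "disjoint_family_on V I"
    and "\<And>a. a \<in> I \<Longrightarrow> finite (V a) \<and> V a \<subseteq> A \<and> 2 ^ card \<T> * (k + n) \<le> card (V a) + n"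
  shows "\<exists>V'. (\<forall>a\<in>I. V' a \<subseteq> V a \<and> k \<le> card (V' a)) \<and>
    (\<forall>(l, a, b)\<in>\<T>. \<forall>x\<in>V' a. \<forall>y\<in>V' b. \<not> E l x y)"
  using assms(1,3-)
proof (induction \<T> arbitrary: V rule: finite_induct)
  case empty
  then show ?case by (intro exI[of _ V]) fastforce
next
  case (insert t \<T>)
  obtain l a b where t: "t = (l, a, b)" by (cases t)
  have ab: "a \<in> I" "b \<in> I" "a \<noteq> b" using insert.prems(2) t by auto
  \<comment> \<open>\<open>K\<close> is what the remaining triples demand of
    \<open>card (V c) + n\<close>. A hole with sides of size \<open>K - n\<close> needs
    \<open>2 * (K - n) + n\<close> vertices, that is,
    \<open>2 * K \<le> card (V c) + n\<close>.\<close>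
  define K where "K = 2 ^ card \<T> * (k + n)"
  have large: "finite (V c)" "V c \<subseteq> A" "2 * K \<le> card (V c) + n" if "c \<in> I" for c
    using insert.prems(4)[OF that] insert.hyps by (auto simp: K_def algebra_simps)
  have K: "n \<le> K" unfolding K_def by (metis le_add2 mult_le_mono1 mult_1 le_trans one_le_numeral one_le_power)
  have hole: "\<exists>U' W'. U' \<subseteq> V a \<and> W' \<subseteq> V b \<and> K - n \<le> card U' \<and> K - n \<le> card W' \<and>
    (\<forall>x\<in>U'. \<forall>y\<in>W'. \<not> E l x y)"
  proof (rule no_long_path_imp_hole[where n = n])
    show "V a \<inter> V b = {}" using insert.prems(3) ab by (auto simp: disjoint_family_on_def)
    show "2 * (K - n) + n \<le> card (V a)" "2 * (K - n) + n \<le> card (V b)"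
      using large[OF ab(1)] large[OF ab(2)] K by linarith+
    show "\<not> (\<exists>p. distinct p \<and> set p \<subseteq> V a \<union> V b \<and> length p = Suc n \<and> successively (E l) p)"
      using insert.prems(1)[of l a b] t large ab by (meson Un_least insertI1 subset_trans)
  qed (use large ab sym in auto)
  then obtain U' W' where UW: "U' \<subseteq> V a" "W' \<subseteq> V b" "K - n \<le> card U'" "K - n \<le> card W'"
    "\<forall>x\<in>U'. \<forall>y\<in>W'. \<not> E l x y" by blast
  define V1 where "V1 = V(a := U', b := W')"
  have V1: "V1 c \<subseteq> V c" for c using UW ab by (auto simp: V1_def)
  have "\<exists>V'. (\<forall>a\<in>I. V' a \<subseteq> V1 a \<and> k \<le> card (V' a)) \<and>
    (\<forall>(l, a, b)\<in>\<T>. \<forall>x\<in>V' a. \<forall>y\<in>V' b. \<not> E l x y)"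
  proof (rule insert.IH)
    show "disjoint_family_on V1 I"
      using insert.prems(3) V1 by (fastforce simp: disjoint_family_on_def)
    fix c assume c: "c \<in> I"
    have "K \<le> card (V1 c) + n"
      using large(3)[OF c] UW K ab by (auto simp: V1_def)
    then show "finite (V1 c) \<and> V1 c \<subseteq> A \<and> 2 ^ card \<T> * (k + n) \<le> card (V1 c) + n"
      using large[OF c] V1[of c] by (auto simp: K_def intro: finite_subset)
  next
    fix l a b assume l: "(l, a, b) \<in> \<T>"
    show "\<not> (\<exists>p. distinct p \<and> set p \<subseteq> A \<and> length p = Suc n \<and> successively (E l) p)"
      by (rule insert.prems(1)[OF insertI2[OF l]])
    show "a \<in> I \<and> b \<in> I \<and> a \<noteq> b" by (rule insert.prems(2)[OF insertI2[OF l]])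
  qed
  then obtain V' where V': "\<forall>a\<in>I. V' a \<subseteq> V1 a \<and> k \<le> card (V' a)"
    "\<forall>(l, a, b)\<in>\<T>. \<forall>x\<in>V' a. \<forall>y\<in>V' b. \<not> E l x y" by blast
  have "V' a \<subseteq> U'" "V' b \<subseteq> W'" using V'(1) ab by (fastforce simp: V1_def)+
  then have "\<forall>x\<in>V' a. \<forall>y\<in>V' b. \<not> E l x y" using UW(5) by blast
  then show ?case using V' V1 t by (intro exI[of _ V']) blast
qed

subsection \<open>Linked gadgets along spines\<close>

fun reach :: "('v \<Rightarrow> 'v set) \<Rightarrow> nat \<Rightarrow> 'v \<Rightarrow> 'v set" where
  "reach nb 0 x = {x}"
| "reach nb (Suc k) x = insert x (\<Union>v\<in>nb x. reach nb k v)"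

lemma reach_subset: "(\<And>x. x \<in> V \<Longrightarrow> nb x \<subseteq> V) \<Longrightarrow> x \<in> V \<Longrightarrow> reach nb k x \<subseteq> V"
  by (induction k arbitrary: x) fastforce+

definition all_windows :: "nat \<Rightarrow> ('v list \<Rightarrow> bool) \<Rightarrow> 'v list \<Rightarrow> bool" where
  "all_windows r \<Phi> l \<longleftrightarrow> (\<forall>i. i + r \<le> length l \<longrightarrow> \<Phi> (take r (drop i l)))"

text \<open>A window of length \<open>r\<close> cannot meet both \<open>xs\<close> and
  \<open>zs\<close>, as \<open>ys\<close> separates them.\<close>

lemma all_windows_append:
  assumes "all_windows r \<Phi> (xs @ ys)" and "all_windows r \<Phi> (ys @ zs)" and "r \<le> length ys"
  shows "all_windows r \<Phi> (xs @ ys @ zs)"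
  unfolding all_windows_def
proof (intro allI impI)
  fix i assume i: "i + r \<le> length (xs @ ys @ zs)"
  show "\<Phi> (take r (drop i (xs @ ys @ zs)))"
  proof (cases "i \<le> length xs")
    case True
    then have "take r (drop i ((xs @ ys) @ zs)) = take r (drop i (xs @ ys))"
      using assms(3) by (subst drop_append, subst take_append) simp
    moreover have "\<Phi> (take r (drop i (xs @ ys)))"
      using assms(1)[unfolded all_windows_def, rule_format, of i] assms(3) True by simp
    ultimately show ?thesis by (simp only: append_assoc)
  next
    case False
    then have "drop i (xs @ ys @ zs) = drop (i - length xs) (ys @ zs)" by simp
    moreover have "\<Phi> (take r (drop (i - length xs) (ys @ zs)))"
      using assms(2)[unfolded all_windows_def, rule_format, of "i - length xs"] i False by simp
    ultimately show ?thesis by (simp only:)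
  qed
qed

lemma all_windows_mono:
  "all_windows r \<Phi> l \<Longrightarrow> (\<And>w. \<Phi> w \<Longrightarrow> set w \<subseteq> set l \<Longrightarrow> \<Psi> w) \<Longrightarrow> all_windows r \<Psi> l"
  unfolding all_windows_def by (meson in_set_dropD in_set_takeD subsetI)

text \<open>Positions along a spine are distinct even if vertices repeat, so every window is the
  image of an \<open>r\<close>-subset of \<open>H\<close>, whatever the order of \<open>is\<close>.
  Hence the two halves of a clique can be concatenated in either order.\<close>

lemma all_windows_map_distinct:
  assumes "distinct is" and "set is \<subseteq> H"
    and "\<And>e. e \<subseteq> H \<Longrightarrow> card e = r \<Longrightarrow> f (image_mset h (mset_set e)) = c"
  shows "all_windows r (\<lambda>w. f (mset w) = c) (map h is)"
  unfolding all_windows_def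
proof (intro allI impI)
  fix i assume i: "i + r \<le> length (map h is)"
  let ?e = "set (take r (drop i is))"
  have d: "distinct (take r (drop i is))" using assms(1) by simp
  have "?e \<subseteq> H" using assms(2) by (meson in_set_dropD in_set_takeD subset_iff)
  moreover have "card ?e = r" using i distinct_card[OF d] by simp
  moreover have "mset (take r (drop i (map h is))) = image_mset h (mset_set ?e)"
    using d by (simp add: take_map drop_map mset_set_set)
  ultimately show "f (mset (take r (drop i (map h is)))) = c" using assms(3) by metis
qed

text \<open>
  A gadget \<open>g u\<close> is a list of \<open>r\<close> vertices attached to \<open>u\<close>. Two gadgets are linked when one and
  the same middle segment \<open>U\<close> continues both of them, forwards and backwards, in colour \<open>c\<close>.
\<close>

definition linked ::
  "'v set \<Rightarrow> ('v \<Rightarrow> 'v set) \<Rightarrow> nat \<Rightarrow> ('v multiset \<Rightarrow> nat) \<Rightarrow> nat \<Rightarrow> ('v \<Rightarrow> 'v list) \<Rightarrow> 'v \<Rightarrow> 'v \<Rightarrow> bool"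
  where "linked V ball r col c g u v \<longleftrightarrow> (\<exists>z\<in>V. \<exists>U. length U = r \<and> length (g u) = r \<and> length (g v) = r \<and>
    u \<in> ball z \<and> v \<in> ball z \<and> set U \<subseteq> ball z \<and> set (g u) \<subseteq> ball z \<and> set (g v) \<subseteq> ball z \<and>
    (\<forall>l\<in>{g u @ U, U @ g u, g v @ U, U @ g v}. all_windows r (\<lambda>w. col (mset w) = c) l))"

lemma linked_sym: "linked V ball r col c g u v \<Longrightarrow> linked V ball r col c g v u"
  unfolding linked_def by blast

text \<open>The \<open>D + 1\<close> heights suffice for Ramsey's theorem, and \<open>B\<close>
  exceeds the number of pairs of a position set and a colour. The exponent in \<open>card_V\<close>
  bounds the number of tuples of a word, a position set, a colour and two children, each of which
  may halve the sets; the factor \<open>4 * B\<close> leaves \<open>B\<close> parts of size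
  \<open>2 * n\<close> times that power inside half of \<open>V\<close>.\<close>

locale tower =
  fixes V :: "'v set" and nb :: "'v \<Rightarrow> 'v set" and n r s B D :: nat
    and col :: "'v multiset \<Rightarrow> nat"
  assumes finite_V: "finite V"
    and nb_subset: "x \<in> V \<Longrightarrow> nb x \<subseteq> V"
    and expanding: "X \<subseteq> V \<Longrightarrow> Y \<subseteq> V \<Longrightarrow> n \<le> card X \<Longrightarrow> n \<le> card Y \<Longrightarrow> \<exists>x\<in>X. nb x \<inter> Y \<noteq> {}"
    and n_pos: "n \<ge> 1"
    and r_pos: "r \<ge> 1"
    and col_less: "col M < s"
    and B_large: "2 ^ Suc D * s < B"
    and card_V: "card V = 4 * B * 2 ^ (B ^ D * 2 ^ Suc D * s * (B * B)) * n"
    and ramsey: "\<And>f :: nat set \<Rightarrow> nat. (\<And>e. e \<subseteq> {..D} \<Longrightarrow> card e = r \<Longrightarrow> f e < s) \<Longrightarrow>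
      \<exists>H c. H \<subseteq> {..D} \<and> card H = 2 * r \<and> c < s \<and> (\<forall>e. e \<subseteq> H \<longrightarrow> card e = r \<longrightarrow> f e = c)"
begin

abbreviation ball :: "'v \<Rightarrow> 'v set" where
  "ball \<equiv> reach nb D"

definition words :: "(nat \<Rightarrow> nat) set" where
  "words = {..<D} \<rightarrow>\<^sub>E {..<B}"

definition long_linked_path :: bool where
  "long_linked_path \<longleftrightarrow> (\<exists>c g p. distinct p \<and> set p \<subseteq> V \<and> length p = Suc n \<and>
    successively (linked V ball r col c g) p)"

text \<open>
  In \<open>spines j W P\<close>, the list \<open>P w x\<close> descends from \<open>x\<close> through \<open>j\<close> levels; its entry at index \<open>i\<close> is
  the vertex at height \<open>i\<close> (so \<open>x\<close> comes last), and \<open>w i\<close> selects the child taken from height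
  \<open>i + 1\<close> to height \<open>i\<close>. Being separated means that two spines branching apart exactly at height \<open>i\<close>
  never carry linked gadgets at equal positions up to \<open>i\<close>.
\<close>

definition separated :: "nat \<Rightarrow> 'v set \<Rightarrow> ((nat \<Rightarrow> nat) \<Rightarrow> 'v \<Rightarrow> 'v list) \<Rightarrow> bool" where
  "separated j W P \<longleftrightarrow> (\<forall>x\<in>W. \<forall>w\<in>words. \<forall>b<B. \<forall>i<j. b \<noteq> w i \<longrightarrow>
    (\<forall>S c z U. S \<subseteq> {..i} \<longrightarrow> card S = r \<longrightarrow> c < s \<longrightarrow> z \<in> V \<longrightarrow> length U = r \<longrightarrow>
      set (P w x) \<union> set (P (w(i := b)) x) \<union> set U \<subseteq> ball z \<longrightarrow>
      \<not> (\<forall>l\<in>{nths (P w x) S @ U, U @ nths (P w x) S,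
              nths (P (w(i := b)) x) S @ U, U @ nths (P (w(i := b)) x) S}.
            all_windows r (\<lambda>w. col (mset w) = c) l)))"

definition spines :: "nat \<Rightarrow> 'v set \<Rightarrow> ((nat \<Rightarrow> nat) \<Rightarrow> 'v \<Rightarrow> 'v list) \<Rightarrow> bool" where
  "spines j W P \<longleftrightarrow> W \<subseteq> V \<and> card V \<le> 2 * card W \<and>
    (\<forall>x\<in>W. \<forall>w\<in>words. length (P w x) = Suc j \<and> last (P w x) = x \<and> set (P w x) \<subseteq> reach nb j x) \<and>
    (\<forall>x\<in>W. \<forall>w\<in>words. \<forall>w'\<in>words. \<forall>i\<le>j. (\<forall>k\<in>{i..<j}. w k = w' k) \<longrightarrow> P w x ! i = P w' x ! i) \<and>
    (\<forall>x. \<forall>w\<in>words. \<forall>w'\<in>words. (\<forall>k<j. w k = w' k) \<longrightarrow> P w x = P w' x) \<and>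
    separated j W P"

lemma spinesD:
  assumes "spines j W P"
  shows "W \<subseteq> V" and "card V \<le> 2 * card W" and "separated j W P"
    and "\<lbrakk>x \<in> W; w \<in> words\<rbrakk> \<Longrightarrow> length (P w x) = Suc j"
    and "\<lbrakk>x \<in> W; w \<in> words\<rbrakk> \<Longrightarrow> last (P w x) = x"
    and "\<lbrakk>x \<in> W; w \<in> words\<rbrakk> \<Longrightarrow> set (P w x) \<subseteq> reach nb j x"
    and "\<lbrakk>x \<in> W; w \<in> words; w' \<in> words; i \<le> j; \<forall>k\<in>{i..<j}. w k = w' k\<rbrakk> \<Longrightarrow> P w x ! i = P w' x ! i"
    and "\<lbrakk>w \<in> words; w' \<in> words; \<forall>k<j. w k = w' k\<rbrakk> \<Longrightarrow> P w x = P w' x"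
  using assms unfolding spines_def by (elim conjE; blast)+

lemma spines_0: "spines 0 V (\<lambda>w x. [x])"
  by (auto simp: spines_def separated_def)

text \<open>One more level of the tree: take \<open>B\<close> disjoint parts of \<open>W\<close>,
  thin them until no gadgets of different parts are linked under any label, and use as new roots the
  vertices with an out-neighbour in each part. By expansion these are still at least half of
  \<open>V\<close>.\<close>

lemma spines_Suc:
  assumes no_path: "\<not> long_linked_path" and j: "j < D" and sp: "spines j W P"
  shows "\<exists>W' P'. spines (Suc j) W' P'"
proof -
  define t where "t = B ^ D * 2 ^ Suc D * s * (B * B)"
  \<comment> \<open>A label fixes a word, a set of positions and a colour; the gadget at
    \<open>u\<close> is the part of its spine at these positions.\<close>
  define E where "E = (\<lambda>(w, S, c). linked V ball r col c (\<lambda>u. nths (P w u) S))"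
  define \<T> where "\<T> = {(l, a, b). l \<in> words \<times> Pow {..D} \<times> {..<s} \<and> a < B \<and> b < B \<and> a \<noteq> b}"
  have finw: "finite words" and cardw: "card words = B ^ D"
    by (auto simp: words_def card_PiE intro!: finite_PiE)
  define \<T>' where "\<T>' = (words \<times> Pow {..D} \<times> {..<s}) \<times> {..<B} \<times> {..<B}"
  have "\<T> \<subseteq> \<T>'" "finite \<T>'" "card \<T>' = t"
    using finw by (auto simp: \<T>_def \<T>'_def t_def card_cartesian_product card_Pow cardw)
  then have fin\<T>: "finite \<T>" and card\<T>: "card \<T> \<le> t"
    using card_mono finite_subset by metis+
  have W: "W \<subseteq> V" "finite W" "card V \<le> 2 * card W"
    using spinesD(1,2)[OF sp] finite_V by (auto intro: finite_subset)
  have Wlarge: "B * (2 ^ t * (n + n)) \<le> card W"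
    using W(3) unfolding card_V t_def[symmetric] by (simp add: algebra_simps)
  have "\<exists>V0. (\<forall>a<B. V0 a \<subseteq> W \<and> card (V0 a) = 2 ^ t * (n + n)) \<and> disjoint_family_on V0 {..<B}"
  proof -
    obtain h where h: "bij_betw h {..<card W} W"
      using W ex_bij_betw_nat_finite[of W] by (auto simp: atLeast0LessThan)
    define m where "m = 2 ^ t * (n + n)"
    define V0 where "V0 a = h ` {a * m..<a * m + m}" for a
    have sub: "{a * m..<a * m + m} \<subseteq> {..<card W}" if "a < B" for a
    proof -
      have "a * m + m \<le> B * m" using that by (metis Suc_leI add.commute mult_Suc mult_le_mono1)
      then show ?thesis using Wlarge by (auto simp: m_def[symmetric])
    qed
    have "V0 a \<inter> V0 b = {}" if ab: "a < B" "b < B" "a \<noteq> b" for a b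
    proof -
      have "{a * m..<a * m + m} \<inter> {b * m..<b * m + m} = {}"
      proof -
        have "x div m = a" if "x \<in> {a * m..<a * m + m}" for x a
          using that by (intro div_nat_eqI) (auto simp: algebra_simps)
        then show ?thesis using ab(3) by blast
      qed
      then show ?thesis
        unfolding V0_def using sub[OF ab(1)] sub[OF ab(2)] h
        by (metis bij_betw_imp_inj_on image_empty inj_on_image_Int)
    qed
    moreover have "V0 a \<subseteq> W \<and> card (V0 a) = m" if "a < B" for a
      using sub[OF that] h unfolding V0_def
      by (metis add_diff_cancel_left' bij_betw_def card_atLeastLessThan card_image image_mono inj_on_subset)
    ultimately show ?thesis
      by (intro exI[of _ V0]) (auto simp: m_def disjoint_family_on_def)
  qed
  then obtain V0 where V0: "\<And>a. a < B \<Longrightarrow> V0 a \<subseteq> W \<and> card (V0 a) = 2 ^ t * (n + n)"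
    "disjoint_family_on V0 {..<B}" by blast
  have "\<exists>V'. (\<forall>a\<in>{..<B}. V' a \<subseteq> V0 a \<and> n \<le> card (V' a)) \<and>
    (\<forall>(l, a, b)\<in>\<T>. \<forall>x\<in>V' a. \<forall>y\<in>V' b. \<not> E l x y)"
  proof (rule no_long_path_imp_simultaneous_holes[where A = V and n = n])
    show "E l x y \<Longrightarrow> E l y x" for l x y
      by (auto simp: E_def split: prod.splits intro: linked_sym)
    show "\<not> (\<exists>p. distinct p \<and> set p \<subseteq> V \<and> length p = Suc n \<and> successively (E l) p)" for l
      using no_path unfolding long_linked_path_def E_def by (cases l) auto
    show "finite (V0 a) \<and> V0 a \<subseteq> V \<and> 2 ^ card \<T> * (n + n) \<le> card (V0 a) + n" if "a \<in> {..<B}" for a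
    proof -
      have a: "V0 a \<subseteq> W" "card (V0 a) = 2 ^ t * (n + n)" using V0(1)[of a] that by auto
      have "2 ^ card \<T> * (n + n) \<le> 2 ^ t * (n + n)"
        using card\<T> by (intro mult_right_mono power_increasing) auto
      also have "\<dots> \<le> card (V0 a) + n" unfolding a(2) by (rule le_add1)
      finally show ?thesis using a(1) W(1,2) by (meson finite_subset subset_trans)
    qed
  qed (use fin\<T> V0 in \<open>auto simp: \<T>_def\<close>)
  then obtain V' where holes: "\<forall>a\<in>{..<B}. V' a \<subseteq> V0 a \<and> n \<le> card (V' a)"
    "\<forall>(l, a, b)\<in>\<T>. \<forall>x\<in>V' a. \<forall>y\<in>V' b. \<not> E l x y" by (elim exE conjE)
  have V': "V' a \<subseteq> V0 a" "n \<le> card (V' a)" if "a < B" for a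
    using holes(1) that by auto
  have no_E: "\<not> E l x y" if "(l, a, b) \<in> \<T>" "x \<in> V' a" "y \<in> V' b" for l a b x y
    using bspec[OF holes(2) that(1)] that by auto
  have V'W: "V' a \<subseteq> W" if "a < B" for a using V'(1) V0(1) that by blast
  define W' where "W' = {x \<in> V. \<forall>a<B. nb x \<inter> V' a \<noteq> {}}"
  define ch where "ch a x = (SOME v. v \<in> nb x \<inter> V' a)" for a x
  have ch: "ch a x \<in> nb x" "ch a x \<in> V' a" if "x \<in> W'" "a < B" for a x
  proof -
    have "\<exists>v. v \<in> nb x \<inter> V' a" using that by (auto simp: W'_def)
    then have "ch a x \<in> nb x \<inter> V' a" unfolding ch_def by (rule someI_ex)
    then show "ch a x \<in> nb x" "ch a x \<in> V' a" by auto
  qed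
  \<comment> \<open>The root is appended last, so that index remains height; letter \<open>j\<close>
    of the word chooses the child.\<close>
  define P' where "P' w x = P w (ch (w j) x) @ [x]" for w x
  have wB: "w k < B" if "w \<in> words" "k < D" for w k
    using that by (auto simp: words_def PiE_iff)
  have upd: "w(i := b) \<in> words" if "w \<in> words" "i < D" "b < B" for w i b
    using that by (auto simp: words_def PiE_iff extensional_def)
  have chW: "ch (w j) x \<in> W" if "x \<in> W'" "w \<in> words" for w x
    using ch(2)[OF that(1) wB[OF that(2) j]] V'W[OF wB[OF that(2) j]] by blast
  note P = spinesD(4-6)[OF sp] and P_top = spinesD(7)[OF sp] and P_low = spinesD(8)[OF sp]
  have "spines (Suc j) W' P'"
    unfolding spines_def
  proof (intro conjI ballI allI impI)
    show "W' \<subseteq> V" by (auto simp: W'_def)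
    \<comment> \<open>Each \<open>V' a\<close> has at least \<open>n\<close> vertices, so by
      expansion at most \<open>n\<close> vertices have no out-neighbour in it.\<close>
    have "card (V - W') \<le> B * n"
    proof -
      have "V - W' = (\<Union>a<B. {x \<in> V. nb x \<inter> V' a = {}})" by (auto simp: W'_def)
      then have "card (V - W') \<le> (\<Sum>a<B. card {x \<in> V. nb x \<inter> V' a = {}})"
        by (simp add: card_UN_le)
      also have "\<dots> \<le> (\<Sum>a<B. n)"
      proof (rule sum_mono)
        fix a assume a: "a \<in> {..<B}"
        show "card {x \<in> V. nb x \<inter> V' a = {}} \<le> n"
        proof (rule ccontr)
          assume "\<not> ?thesis"
          then have "\<exists>x\<in>{x \<in> V. nb x \<inter> V' a = {}}. nb x \<inter> V' a \<noteq> {}"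
            using V'(2)[of a] V'W[of a] W a by (intro expanding) auto
          then show False by auto
        qed
      qed
      finally show ?thesis by simp
    qed
    moreover have "2 * (B * n) \<le> card V"
    proof -
      have "2 * (B * n) \<le> (4 * 2 ^ t) * (B * n)"
        by (intro mult_right_mono) (auto intro: order_trans[of _ "4 * 1"])
      then show ?thesis using card_V by (simp add: t_def mult_ac)
    qed
    moreover have "card V = card W' + card (V - W')"
      using finite_V card_mono[of V W'] by (simp add: W'_def card_Diff_subset)
    ultimately show "card V \<le> 2 * card W'" by linarith
  next
    fix x w assume x: "x \<in> W'" "w \<in> words"
    show "length (P' w x) = Suc (Suc j)" using P(1)[OF chW[OF x] x(2)] by (simp add: P'_def)
    show "last (P' w x) = x" by (simp add: P'_def)
    show "set (P' w x) \<subseteq> reach nb (Suc j) x"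
      using P(3)[OF chW[OF x] x(2)] ch(1)[OF x(1) wB[OF x(2) j]] by (auto simp: P'_def)
  next
    fix x w w' i
    assume x: "x \<in> W'" "w \<in> words" "w' \<in> words" and i: "i \<le> Suc j"
      and eq: "\<forall>k\<in>{i..<Suc j}. w k = w' k"
    note len = P(1)[OF chW[OF x(1,2)] x(2)] P(1)[OF chW[OF x(1,3)] x(3)]
    show "P' w x ! i = P' w' x ! i"
    proof (cases "i = Suc j")
      case True
      then show ?thesis using len by (simp add: P'_def nth_append)
    next
      case False
      then have "i \<le> j" "w j = w' j" using i eq by auto
      then show ?thesis
        using len eq P_top[OF chW[OF x(1,2)] x(2,3)] by (simp add: P'_def nth_append)
    qed
  next
    fix x w w' assume w: "w \<in> words" "w' \<in> words" and eq: "\<forall>k<Suc j. w k = w' k"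
    then show "P' w x = P' w' x" using P_low[OF w] by (simp add: P'_def)
  next
    show "separated (Suc j) W' P'"
      unfolding separated_def
    proof (intro ballI allI impI)
      fix x w b i S c z U
      assume x: "x \<in> W'" "w \<in> words" and b: "b < B" and i: "i < Suc j" and bw: "b \<noteq> w i"
        and S: "S \<subseteq> {..i}" "card S = r" and c: "c < s" and z: "z \<in> V" and U: "length U = r"
        and sub: "set (P' w x) \<union> set (P' (w(i := b)) x) \<union> set U \<subseteq> ball z"
      let ?w' = "w(i := b)"
      have w': "?w' \<in> words" using upd x(2) i j b by auto
      let ?u = "ch (w j) x" and ?v = "ch (?w' j) x"
      note uW = chW[OF x] and vW = chW[OF x(1) w']
      note Pu = P[OF uW x(2)] and Pv = P[OF vW w']
      \<comment> \<open>\<open>S\<close> lies at or below \<open>i\<close>, and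
        \<open>i \<le> j\<close>, so the new root at index \<open>Suc j\<close> is never
        selected.\<close>
      have "nths (l @ [y]) S = nths l S" if "length l = Suc j" for l :: "'v list" and y
        using that S i by (subst nths_append) (auto simp: nths_singleton)
      then have nths: "nths (P' w x) S = nths (P w ?u) S" "nths (P' ?w' x) S = nths (P ?w' ?v) S"
        unfolding P'_def using Pu(1) Pv(1) by blast+
      show "\<not> (\<forall>l\<in>{nths (P' w x) S @ U, U @ nths (P' w x) S,
          nths (P' ?w' x) S @ U, U @ nths (P' ?w' x) S}. all_windows r (\<lambda>w. col (mset w) = c) l)"
      \<comment> \<open>If \<open>i = j\<close>, the spines part at the new root: the children lie
        in different thinned parts and carry gadgets of one label, since letter \<open>j\<close>
        does not affect the spines below. If \<open>i < j\<close>, they share the child and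
        separation is inherited.\<close>
      proof (cases "i = j")
        case True
        have same: "P ?w' ?v = P w ?v" using P_low[OF w' x(2)] True by auto
        have "((w, S, c), w j, b) \<in> \<T>"
          using x(2) S i c b bw wB[OF x(2) j] j True by (auto simp: \<T>_def)
        moreover have "?u \<in> V' (w j)" "?v \<in> V' b" using ch(2) x wB[OF x(2) j] b True by auto
        ultimately have "\<not> E (w, S, c) ?u ?v" using no_E by blast
        \<comment> \<open>Each child is the last entry of its own spine.\<close>
        moreover have "?u \<in> ball z" "?v \<in> ball z"
          using sub Pu(1,2) Pv(1,2) by (auto simp: P'_def) (metis last_in_set list.size(3) nat.simps(3) subsetD)+
        moreover have "length (nths (P w ?u) S) = r" "length (nths (P w ?v) S) = r"
          using Pu(1) Pv(1) same S i by (auto simp: length_nths intro!: arg_cong[where f = card])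
        moreover have "set (nths (P w ?u) S) \<subseteq> ball z" "set (nths (P w ?v) S) \<subseteq> ball z"
          using sub same by (auto simp: P'_def dest!: in_set_nthsD)
        ultimately show ?thesis
          using z U sub unfolding E_def linked_def nths same by auto
      next
        case False
        then have "i < j" "?v = ?u" using i by auto
        then have "\<not> (\<forall>l\<in>{nths (P w ?u) S @ U, U @ nths (P w ?u) S,
          nths (P ?w' ?u) S @ U, U @ nths (P ?w' ?u) S}. all_windows r (\<lambda>w. col (mset w) = c) l)"
          using spinesD(3)[OF sp, unfolded separated_def] uW x(2) b bw S c z U sub unfolding P'_def by auto
        then show ?thesis unfolding nths using \<open>?v = ?u\<close> by simp
      qed
    qed
  qed
  then show ?thesis by blast
qed

end

text \<open>
  If \<open>\<Phi>\<close> assigns to every word one of fewer than \<open>B\<close> values, each naming a coordinate \<open>h\<close>, then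
  two words with the same value differ only in the coordinate named by it: otherwise deleting that
  coordinate would be injective on every fibre.
\<close>

lemma words_differing_at_named_coordinate:
  fixes \<Phi> :: "(nat \<Rightarrow> nat) \<Rightarrow> 'c" and h :: "'c \<Rightarrow> nat"
  assumes fin: "finite C" and \<Phi>: "\<And>w. w \<in> {..<D} \<rightarrow>\<^sub>E {..<B} \<Longrightarrow> \<Phi> w \<in> C"
    and h: "\<And>c. c \<in> C \<Longrightarrow> h c < D" and B: "card C < B"
  shows "\<exists>w\<in>{..<D} \<rightarrow>\<^sub>E {..<B}. \<exists>b<B. b \<noteq> w (h (\<Phi> w)) \<and> \<Phi> (w(h (\<Phi> w) := b)) = \<Phi> w"
proof (rule ccontr)
  assume none: "\<not> ?thesis"
  let ?W = "{..<D} \<rightarrow>\<^sub>E {..<B}"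
  have finW: "finite ?W" by (intro finite_PiE) auto
  have fibre: "card {w \<in> ?W. \<Phi> w = c} \<le> B ^ (D - 1)" if c: "c \<in> C" for c
  proof -
    let ?del = "\<lambda>w :: nat \<Rightarrow> nat. restrict w ({..<D} - {h c})"
    have "inj_on ?del {w \<in> ?W. \<Phi> w = c}"
    proof (rule inj_onI)
      fix w w' assume w: "w \<in> {w \<in> ?W. \<Phi> w = c}" and w': "w' \<in> {w \<in> ?W. \<Phi> w = c}"
        and eq: "?del w = ?del w'"
      have "w' i = (w(h c := w' (h c))) i" for i
      proof (cases "i \<in> {..<D} - {h c}")
        case True
        then show ?thesis using fun_cong[OF eq, of i] by auto
      next
        case False
        then show ?thesis using w w' by (auto simp: PiE_iff extensional_def)
      qed
      then have w'_eq: "w' = w(h c := w' (h c))" by blast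
      have "w' (h c) < B" using w' h[OF c] by (auto simp: PiE_iff)
      then have "w' (h c) = w (h c)" using none w w' w'_eq by (metis (mono_tags, lifting) mem_Collect_eq)
      then show "w = w'" using w'_eq by simp
    qed
    moreover have "?del ` {w \<in> ?W. \<Phi> w = c} \<subseteq> ({..<D} - {h c}) \<rightarrow>\<^sub>E {..<B}"
      by (intro image_subsetI) (simp add: restrict_PiE_iff PiE_iff)
    moreover have "finite (({..<D} - {h c}) \<rightarrow>\<^sub>E {..<B})"
      by (intro finite_PiE) auto
    ultimately have "card {w \<in> ?W. \<Phi> w = c} \<le> card (({..<D} - {h c}) \<rightarrow>\<^sub>E {..<B})"
      by (rule card_inj_on_le)
    also have "\<dots> = B ^ (D - 1)" using h[OF c] by (simp add: card_PiE)
    finally show ?thesis .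
  qed
  have "B ^ D = card ?W" by (simp add: card_PiE)
  also have "\<dots> = card (\<Union>c\<in>C. {w \<in> ?W. \<Phi> w = c})"
    by (rule arg_cong[where f = card]) (use \<Phi> in blast)
  also have "\<dots> \<le> (\<Sum>c\<in>C. card {w \<in> ?W. \<Phi> w = c})"
    using fin by (rule card_UN_le)
  also have "\<dots> \<le> card C * B ^ (D - 1)"
    using sum_bounded_above[OF fibre] by simp
  finally have le: "B ^ D \<le> card C * B ^ (D - 1)" .
  have "B > 0" using B by simp
  then obtain w where "w \<in> ?W" by (metis PiE_eq_empty_iff all_not_in_conv empty_iff lessThan_iff)
  then have "D > 0" using h[OF \<Phi>] by fastforce
  then have "B ^ D = B * B ^ (D - 1)" by (simp add: power_eq_if)
  then show False using le B by simp
qed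

text \<open>\<open>h\<close> is the \<open>r\<close>-th smallest element of \<open>H\<close>. It
  serves as the named coordinate: changing letter \<open>h\<close> alters a spine only at heights up
  to \<open>h\<close>, hence not on \<open>T\<close>.\<close>

lemma split_at_median:
  fixes H :: "nat set"
  assumes "H \<subseteq> {..D}" and "card H = 2 * r" and "r \<ge> 1"
  obtains S T h where "H = S \<union> T" "S \<inter> T = {}" "card S = r" "card T = r" "S \<subseteq> {..h}" "T \<subseteq> {h<..D}" "h < D"
proof -
  define l where "l = sorted_list_of_set H"
  define h where "h = l ! (r - 1)"
  have fin: "finite H" using assms(1) finite_subset by blast
  have l: "sorted_wrt (<) l" "set l = H" "length l = 2 * r"
    using fin assms(2) by (auto simp: l_def)
  then have d: "distinct l" by (simp add: strict_sorted_iff)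
  have low: "set (take r l) \<subseteq> {..h}"
  proof
    fix y assume "y \<in> set (take r l)"
    then obtain i where "i < r" "y = l ! i" using l(3) by (auto simp: in_set_conv_nth)
    moreover from this have "i \<le> r - 1" "r - 1 < length l" using l(3) by auto
    ultimately show "y \<in> {..h}"
      using sorted_nth_mono[OF strict_sorted_imp_sorted[OF l(1)]] by (simp add: h_def)
  qed
  have high: "set (drop r l) \<subseteq> {h<..D}"
  proof
    fix y assume y: "y \<in> set (drop r l)"
    then obtain i where i: "i < r" "y = l ! (r + i)" using l(3) by (auto simp: in_set_conv_nth)
    have "h < y"
      unfolding h_def i(2) by (rule sorted_wrt_nth_less[OF l(1)]) (use i l(3) assms(3) in auto)
    moreover have "y \<le> D" using in_set_dropD[OF y] l(2) assms(1) by auto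
    ultimately show "y \<in> {h<..D}" by simp
  qed
  have "set (drop r l) \<noteq> {}" using l(3) assms(3) by auto
  then have "h < D" using high by fastforce
  moreover have "H = set (take r l) \<union> set (drop r l)"
    by (metis append_take_drop_id set_append l(2))
  moreover have "set (take r l) \<inter> set (drop r l) = {}"
    using d by (metis append_take_drop_id distinct_append)
  moreover have "card (set (take r l)) = r" "card (set (drop r l)) = r"
    using distinct_card[of "take r l"] distinct_card[of "drop r l"] d l(3) by simp_all
  ultimately show thesis using that low high by blast
qed

lemma nths_conv_map_nth:
  assumes "S \<subseteq> {..<length l}"
  shows "nths l S = map ((!) l) (sorted_list_of_set S)"
proof -
  have "finite S" using assms finite_subset by blast
  have "zip l [0..<length l] = map (\<lambda>i. (l ! i, i)) [0..<length l]"
    by (rule nth_equalityI) auto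
  then have "nths l S = map ((!) l) (filter (\<lambda>i. i \<in> S) [0..<length l])"
    by (simp add: nths_def filter_map o_def)
  also have "filter (\<lambda>i. i \<in> S) [0..<length l] = sorted_list_of_set S"
    using assms \<open>finite S\<close> by (intro sorted_distinct_set_unique) (auto intro: sorted_wrt_filter)
  finally show ?thesis .
qed

context tower
begin

text \<open>
  Otherwise there are spines of full height. Ramsey's theorem, applied to the heights, gives on each
  spine a monochromatic set of \<open>2 r\<close> vertices; two spines with the same set and colour that differ
  only in the choice between its lower and its upper half have linked lower halves, with the common
  upper half as the middle segment.
\<close>

lemma long_linked_path: long_linked_path
proof (rule ccontr)
  assume no_path: "\<not> long_linked_path"
  have "\<exists>W P. spines j W P" if "j \<le> D" for j
    using that
  proof (induction j)
    case 0
    then show ?case using spines_0 by blast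
  next
    case (Suc j)
    then show ?case using spines_Suc[OF no_path] by (metis Suc_le_lessD Suc_leD)
  qed
  then obtain W P where sp: "spines D W P" by blast
  have B_pos: "B > 0" using B_large by simp
  then have "card V > 0" using card_V n_pos by simp
  then obtain x where x: "x \<in> W" using spinesD(2)[OF sp] by fastforce
  have xV: "x \<in> V" using x spinesD(1)[OF sp] by auto
  \<comment> \<open>The \<open>r\<close>-sets of heights are coloured through the multiset of spine
    entries, since a spine may visit a vertex repeatedly.\<close>
  define hom where "hom w H c \<longleftrightarrow> H \<subseteq> {..D} \<and> card H = 2 * r \<and> c < s \<and>
    (\<forall>e. e \<subseteq> H \<longrightarrow> card e = r \<longrightarrow> col (image_mset ((!) (P w x)) (mset_set e)) = c)" for w H c
  have "\<exists>p. hom w (fst p) (snd p)" for w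
    using ramsey[of "\<lambda>e. col (image_mset ((!) (P w x)) (mset_set e))"] col_less
    unfolding hom_def by auto
  then obtain \<Phi> where \<Phi>: "\<And>w. hom w (fst (\<Phi> w)) (snd (\<Phi> w))" by metis
  define C where "C = {H. H \<subseteq> {..D} \<and> card H = 2 * r} \<times> {..<s}"
  have finC: "finite C" unfolding C_def by (intro finite_cartesian_product) auto
  have "card {H. H \<subseteq> {..D} \<and> card H = 2 * r} \<le> card (Pow {..D})"
    by (intro card_mono) auto
  then have cardC: "card C < B"
    using B_large unfolding C_def
    by (simp add: card_cartesian_product card_Pow) (meson le_less_trans mult_le_mono1)
  have \<Phi>C: "\<Phi> w \<in> C" for w using \<Phi>[of w] by (auto simp: C_def hom_def mem_Times_iff)
  have "\<exists>h S T. H = S \<union> T \<and> S \<inter> T = {} \<and> card S = r \<and> card T = r \<and> S \<subseteq> {..h} \<and> T \<subseteq> {h<..D} \<and> h < D"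
    if "H \<subseteq> {..D}" "card H = 2 * r" for H
    using split_at_median[OF that r_pos] by metis
  then obtain med where med: "\<And>H. H \<subseteq> {..D} \<Longrightarrow> card H = 2 * r \<Longrightarrow> \<exists>S T. H = S \<union> T \<and> S \<inter> T = {} \<and>
      card S = r \<and> card T = r \<and> S \<subseteq> {..med H} \<and> T \<subseteq> {med H<..D} \<and> med H < D"
    by metis
  \<comment> \<open>The median depends only on the position set, so two words with equal
    \<open>\<Phi>\<close> name the same coordinate.\<close>
  define h where "h p = med (fst p)" for p :: "nat set \<times> nat"
  have split: "\<exists>S T. fst p = S \<union> T \<and> S \<inter> T = {} \<and> card S = r \<and> card T = r \<and> S \<subseteq> {..h p} \<and>
      T \<subseteq> {h p<..D} \<and> h p < D" if "p \<in> C" for p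
    using med[of "fst p"] that unfolding h_def C_def by (simp add: mem_Times_iff)
  have "\<exists>w\<in>{..<D} \<rightarrow>\<^sub>E {..<B}. \<exists>b<B. b \<noteq> w (h (\<Phi> w)) \<and> \<Phi> (w(h (\<Phi> w) := b)) = \<Phi> w"
    by (rule words_differing_at_named_coordinate[OF finC]) (use \<Phi>C split cardC in blast)+
  then obtain w b where w: "w \<in> words" and b: "b < B" "b \<noteq> w (h (\<Phi> w))"
    and same: "\<Phi> (w(h (\<Phi> w) := b)) = \<Phi> w"
    unfolding words_def by blast
  obtain S T where ST: "fst (\<Phi> w) = S \<union> T" "S \<inter> T = {}" "card S = r" "card T = r"
    "S \<subseteq> {..h (\<Phi> w)}" "T \<subseteq> {h (\<Phi> w)<..D}" "h (\<Phi> w) < D"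
    using split[OF \<Phi>C[of w]] by (elim exE conjE)
  define w' where "w' = w(h (\<Phi> w) := b)"
  have w': "w' \<in> words" using w b(1) ST(7) unfolding w'_def words_def by (auto simp: PiE_iff extensional_def)
  define c where "c = snd (\<Phi> w)"
  have homs: "hom w (S \<union> T) c" "hom w' (S \<union> T) c"
    using \<Phi>[of w] \<Phi>[of w', unfolded w'_def same, folded w'_def] unfolding ST(1) c_def .
  have finST: "finite S" "finite T" using ST(5,6) finite_subset by blast+
  define sl tl where "sl = sorted_list_of_set S" and "tl = sorted_list_of_set T"
  have lists: "set sl = S" "set tl = T" "distinct sl" "distinct tl" "sorted sl"
    using finST by (auto simp: sl_def tl_def)
  define U where "U = map ((!) (P w x)) tl"
  \<comment> \<open>Entry \<open>i\<close> depends only on the letters from \<open>i\<close> on, so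
    above the median the two spines agree and \<open>U\<close> can serve as the common middle
    segment.\<close>
  have U': "U = map ((!) (P w' x)) tl"
    unfolding U_def
  proof (intro map_cong refl)
    fix i assume "i \<in> set tl"
    then have "h (\<Phi> w) < i" "i \<le> D" using ST(6) lists by auto
    then show "P w x ! i = P w' x ! i"
      by (intro spinesD(7)[OF sp x w w']) (auto simp: w'_def)
  qed
  have nths_eq: "nths (P v x) S = map ((!) (P v x)) sl" if "v \<in> words" for v
    unfolding sl_def using ST(5,7) spinesD(4)[OF sp x that] by (intro nths_conv_map_nth) auto
  have windows: "all_windows r (\<lambda>u. col (mset u) = c) (nths (P v x) S @ map ((!) (P v x)) tl)"
      "all_windows r (\<lambda>u. col (mset u) = c) (map ((!) (P v x)) tl @ nths (P v x) S)"
    if v: "v \<in> words" "hom v (S \<union> T) c" for v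
    unfolding nths_eq[OF v(1)] map_append[symmetric]
    using v(2) lists ST(2)
    by (intro all_windows_map_distinct[where H = "S \<union> T"]; simp add: hom_def Int_commute)+
  have sub: "set (P v x) \<subseteq> ball x" if "v \<in> words" for v
    by (rule spinesD(6)[OF sp x that])
  have "set U \<subseteq> set (P w x)"
    using spinesD(4)[OF sp x w] lists ST(6) by (auto simp: U_def)
  then have subs: "set (P w x) \<union> set (P w' x) \<union> set U \<subseteq> ball x" using sub[OF w] sub[OF w'] by blast
  have lenU: "length U = r" using lists ST(4) distinct_card[of tl] by (simp add: U_def)
  have c: "c < s" using homs(1) unfolding hom_def by blast
  have "separated D W P" by (rule spinesD(3)[OF sp])
  \<comment> \<open>Separation is applied with the root \<open>x\<close> itself as centre of the
    ball; it excludes exactly the four monochromatic lists supplied by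
    \<open>windows\<close>.\<close>
  note this[unfolded separated_def, THEN bspec, OF x, THEN bspec, OF w, THEN spec, THEN mp, OF b(1),
      THEN spec, THEN mp, OF ST(7), THEN mp, OF b(2), THEN spec, THEN spec, THEN spec, THEN spec,
      THEN mp, OF ST(5), THEN mp, OF ST(3), THEN mp, OF c, THEN mp, OF xV, THEN mp, OF lenU,
      folded w'_def, THEN mp, OF subs]
  then show False
    using windows[OF w homs(1), folded U_def] windows[OF w' homs(2), folded U'] by simp
qed

end

subsection \<open>Homogeneous blow-ups\<close>

text \<open>Edges may contain several copies of a vertex, hence multisets of vertices.\<close>

definition homogeneous :: "nat \<Rightarrow> 'v set \<Rightarrow> ('v \<Rightarrow> 'k set) \<Rightarrow> (('v \<times> 'k) set \<Rightarrow> nat) \<Rightarrow> bool" where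
  "homogeneous r X S \<chi> \<longleftrightarrow> (\<forall>e e'. e \<subseteq> Sigma X S \<longrightarrow> e' \<subseteq> Sigma X S \<longrightarrow> card e = r \<longrightarrow> card e' = r \<longrightarrow>
    image_mset fst (mset_set e) = image_mset fst (mset_set e') \<longrightarrow> \<chi> e = \<chi> e')"

lemma homogeneous_mono:
  assumes "homogeneous r X S \<chi>" and "\<And>x. x \<in> X \<Longrightarrow> S' x \<subseteq> S x"
  shows "homogeneous r X S' \<chi>"
proof -
  have "Sigma X S' \<subseteq> Sigma X S" using assms(2) by blast
  then show ?thesis
    unfolding homogeneous_def
    by (intro allI impI assms(1)[unfolded homogeneous_def, rule_format]) auto
qed

text \<open>
  The copies of the different vertices are taken from consecutive intervals of a single Ramsey set,
  so the increasing enumeration of an edge lists its vertices in a fixed order and the sequence of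
  vertices is determined by their multiplicities.
\<close>

lemma homogeneous_copies_exist:
  fixes r s m M :: nat
  shows "\<exists>K. \<forall>(X :: 'v set) (T :: 'v \<Rightarrow> nat set) \<chi>. finite X \<longrightarrow> card X \<le> M \<longrightarrow>
    (\<forall>x\<in>X. finite (T x) \<and> K \<le> card (T x)) \<longrightarrow> (\<forall>e. \<chi> e < s) \<longrightarrow>
    (\<exists>S. (\<forall>x\<in>X. S x \<subseteq> T x \<and> card (S x) = m) \<and> homogeneous r X S \<chi>)"
proof -
  define Wd where "Wd = {w. set w \<subseteq> {..<M} \<and> length w = r}"
  \<comment> \<open>Palette for Ramsey's theorem: a single colour of an \<open>r\<close>-set of copy
    numbers records the colours of the edges it yields for all patterns \<open>w\<close> of vertices
    at once.\<close>
  define \<Omega> where "\<Omega> = (Wd \<rightarrow>\<^sub>E {..<s})"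
  have "finite Wd" unfolding Wd_def by (rule finite_lists_length_eq) simp
  then have fin\<Omega>: "finite \<Omega>" unfolding \<Omega>_def by (intro finite_PiE) auto
  obtain code where code: "bij_betw code \<Omega> {..<card \<Omega>}"
    using ex_bij_betw_finite_nat[OF fin\<Omega>] by (auto simp: atLeast0LessThan)
  obtain K :: nat where K: "partn_lst {..<K} (replicate (card \<Omega>) (M * m)) r"
    using ramsey_full by blast
  show ?thesis
  proof (intro exI[of _ K] allI impI)
    fix X :: "'v set" and T :: "'v \<Rightarrow> nat set" and \<chi> :: "('v \<times> nat) set \<Rightarrow> nat"
    assume X: "finite X" "card X \<le> M" and T: "\<forall>x\<in>X. finite (T x) \<and> K \<le> card (T x)" and \<chi>: "\<forall>e. \<chi> e < s"
    obtain \<xi> where \<xi>: "bij_betw \<xi> {..<card X} X"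
      using ex_bij_betw_nat_finite[OF X(1)] by (auto simp: atLeast0LessThan)
    have "\<exists>\<tau>. inj_on \<tau> {..<K} \<and> \<tau> ` {..<K} \<subseteq> T x" if "x \<in> X" for x
      using T that card_le_inj[of "{..<K}" "T x"] by auto
    then obtain \<tau> where \<tau>: "\<And>x. x \<in> X \<Longrightarrow> inj_on (\<tau> x) {..<K}" "\<And>x. x \<in> X \<Longrightarrow> \<tau> x ` {..<K} \<subseteq> T x"
      by metis
    \<comment> \<open>\<open>\<tau>\<close> embeds the common numbers \<open>{..<K}\<close> into the
      possibly different copy sets \<open>T x\<close>, so one Ramsey set works for all
      vertices.\<close>
    define copy where "copy i a = (\<xi> i, \<tau> (\<xi> i) a)" for i a
    define F where "F A = (\<lambda>w\<in>Wd. \<chi> ((\<lambda>k. copy (w ! k) (sorted_list_of_set A ! k)) ` {..<r}))" for A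
    have F: "F A \<in> \<Omega>" for A unfolding F_def \<Omega>_def by (simp add: restrict_PiE_iff \<chi>)
    have "(\<lambda>A. code (F A)) \<in> nsets {..<K} r \<rightarrow> {..<card \<Omega>}"
      by (intro Pi_I) (use F bij_betwE[OF code] in blast)
    then obtain i H where H: "H \<in> nsets {..<K} (M * m)" "(\<lambda>A. code (F A)) ` nsets H r \<subseteq> {i}"
      by (rule partn_lstE[OF K]) auto
    have F_eq: "F A = F A'" if "A \<in> nsets H r" "A' \<in> nsets H r" for A A'
    proof -
      have "code (F A) = code (F A')" using H(2) that by auto
      then show ?thesis using F code by (meson bij_betw_def inj_onD)
    qed
    define hs where "hs = sorted_list_of_set H"
    have hs: "sorted_wrt (<) hs" "set hs = H" "length hs = M * m" "H \<subseteq> {..<K}"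
      using H(1) by (auto simp: hs_def nsets_def)
    \<comment> \<open>Vertex number \<open>p div m\<close> owns a block of \<open>m\<close>
      consecutive elements of the Ramsey set.\<close>
    define R where "R p = copy (p div m) (hs ! p)" for p
    define S where "S x = {y. (x, y) \<in> R ` {..<card X * m}}" for x
    have le: "card X * m \<le> length hs" using X hs by simp
    have hsK: "hs ! p < K" if "p < card X * m" for p
      using that le hs by (metis lessThan_iff less_le_trans nth_mem subsetD)
    have divX: "p div m < card X" if "p < card X * m" for p
      using that by (simp add: less_mult_imp_div_less)
    have \<xi>X: "\<xi> i \<in> X" if "i < card X" for i using bij_betwE[OF \<xi>] that by blast
    have injR: "inj_on R {..<card X * m}"
    proof (rule inj_onI)
      fix p q assume p: "p \<in> {..<card X * m}" and q: "q \<in> {..<card X * m}" and eq: "R p = R q"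
      have d: "p div m = q div m"
        using eq \<xi> divX p q unfolding R_def copy_def by (auto simp: bij_betw_def inj_on_def)
      then have "\<tau> (\<xi> (p div m)) (hs ! p) = \<tau> (\<xi> (p div m)) (hs ! q)"
        using eq by (simp add: R_def copy_def)
      then have "hs ! p = hs ! q"
        using \<tau>(1)[OF \<xi>X[OF divX]] p q hsK by (auto simp: inj_on_def)
      then show "p = q"
        using hs(1) p q le by (simp add: nth_eq_iff_index_eq strict_sorted_iff)
    qed
    have RX: "R ` {..<card X * m} \<subseteq> Sigma X T"
    proof
      fix e assume "e \<in> R ` {..<card X * m}"
      then obtain p where p: "p < card X * m" "e = R p" by auto
      have "\<tau> (\<xi> (p div m)) (hs ! p) \<in> T (\<xi> (p div m))"
        using \<tau>(2)[OF \<xi>X[OF divX[OF p(1)]]] hsK[OF p(1)] by auto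
      then show "e \<in> Sigma X T"
        using \<xi>X[OF divX[OF p(1)]] p(2) by (simp add: R_def copy_def)
    qed
    have SR: "Sigma X S \<subseteq> R ` {..<card X * m}" by (auto simp: S_def)
    show "\<exists>S. (\<forall>x\<in>X. S x \<subseteq> T x \<and> card (S x) = m) \<and> homogeneous r X S \<chi>"
    proof (intro exI[of _ S] conjI ballI)
      fix x assume x: "x \<in> X"
      show "S x \<subseteq> T x" using RX by (auto simp: S_def)
      obtain i where i: "i < card X" "x = \<xi> i"
        using x \<xi> by (metis bij_betw_def imageE lessThan_iff)
      have sub: "{i * m..<i * m + m} \<subseteq> {..<card X * m}"
      proof -
        have "Suc i * m \<le> card X * m" using i(1) by (intro mult_le_mono1) simp
        then show ?thesis by auto
      qed
      have "Pair x ` S x = R ` {i * m..<i * m + m}"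
      proof
        show "Pair x ` S x \<subseteq> R ` {i * m..<i * m + m}"
        proof
          fix e assume e: "e \<in> Pair x ` S x"
          then have "e \<in> R ` {..<card X * m}" unfolding S_def by blast
          moreover have "fst e = x" using e by auto
          ultimately obtain p where p: "p < card X * m" "e = R p" "fst (R p) = x" by blast
          then have "\<xi> (p div m) = \<xi> i" using i by (simp add: R_def copy_def)
          then have pd: "p div m = i"
            using \<xi> divX[OF p(1)] i(1) by (auto simp: bij_betw_def inj_on_def)
          have "m > 0" using p(1) by (cases m) auto
          then have "p \<in> {i * m..<i * m + m}"
            using pd dividend_less_div_times[of m p] by (auto simp: add.commute)
          then show "e \<in> R ` {i * m..<i * m + m}" using p by blast
        qed
        show "R ` {i * m..<i * m + m} \<subseteq> Pair x ` S x"
        proof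
          fix e assume "e \<in> R ` {i * m..<i * m + m}"
          then obtain p where p: "p \<in> {i * m..<i * m + m}" "e = R p" by auto
          then have "p div m = i" by (intro div_nat_eqI) (auto simp: algebra_simps)
          then have "R p = (x, snd (R p))" by (simp add: R_def copy_def i)
          moreover have "R p \<in> R ` {..<card X * m}" using p sub by blast
          ultimately show "e \<in> Pair x ` S x" using p(2) by (auto simp: S_def intro: rev_image_eqI)
        qed
      qed
      moreover have "card (Pair x ` S x) = card (S x)" by (rule card_image) (auto simp: inj_on_def)
      moreover have "card (R ` {i * m..<i * m + m}) = m"
        using inj_on_subset[OF injR sub] by (simp add: card_image)
      ultimately show "card (S x) = m" by simp
    next
      define \<iota> where "\<iota> = the_inv_into {..<card X} \<xi>"
      have \<iota>: "\<iota> (\<xi> i) = i" if "i < card X" for i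
        using the_inv_into_f_f[of \<xi> "{..<card X}" i] \<xi> that by (auto simp: \<iota>_def bij_betw_def)
      have key: "\<exists>A\<in>nsets H r. \<chi> e = F A (sorted_list_of_multiset (image_mset \<iota> (image_mset fst (mset_set e))))"
        if e: "e \<subseteq> Sigma X S" "card e = r" for e
      proof -
        obtain P where P: "P \<subseteq> {..<card X * m}" "e = R ` P" using e SR by (meson order_trans subset_imageE)
        have injP: "inj_on R P" using injR P(1) by (rule inj_on_subset)
        have finP: "finite P" using P(1) finite_subset by blast
        have cardP: "card P = r" using e(2) P(2) injP by (simp add: card_image)
        define ps where "ps = sorted_list_of_set P"
        have ps: "sorted_wrt (<) ps" "set ps = P" "length ps = r" "mset ps = mset_set P"
          using finP cardP mset_set_set[of ps] by (auto simp: ps_def)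
        have psX: "p < card X * m" if "p \<in> set ps" for p using that ps P by auto
        define w where "w = map (\<lambda>p. p div m) ps"
        have wWd: "w \<in> Wd"
          using ps(3) divX[OF psX] X(2) by (force simp: Wd_def w_def)
        have "mset w = image_mset (\<lambda>p. \<iota> (fst (R p))) (mset_set P)"
          unfolding w_def mset_map ps(4) using P(1) finP
          by (intro image_mset_cong) (auto simp: R_def copy_def \<iota> divX)
        also have "\<dots> = image_mset \<iota> (image_mset fst (mset_set e))"
          unfolding P(2) image_mset_mset_set[OF injP, symmetric] by (simp add: multiset.map_comp o_def)
        finally have "mset w = \<dots>" .
        \<comment> \<open>As \<open>p div m\<close> is monotone in \<open>p\<close>, the pattern of
          an edge is sorted and thus recoverable from its multiset.\<close>
        moreover have "sorted w"
          unfolding w_def sorted_map using strict_sorted_imp_sorted[OF ps(1)]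
          by (rule sorted_wrt_mono_rel[rotated]) (rule div_le_mono)
        ultimately have w: "w = sorted_list_of_multiset (image_mset \<iota> (image_mset fst (mset_set e)))"
          by (metis sorted_list_of_multiset_mset sorted_sort_id)
        define A where "A = set (map ((!) hs) ps)"
        have "sorted_wrt (<) (map ((!) hs) ps)"
          unfolding sorted_wrt_map
        proof (rule sorted_wrt_mono_rel[OF _ ps(1)])
          fix p q assume "p \<in> set ps" "q \<in> set ps" "p < q"
          then show "hs ! p < hs ! q"
            using psX[of q] le by (intro sorted_wrt_nth_less[OF hs(1)]) auto
        qed
        then have A: "sorted_list_of_set A = map ((!) hs) ps"
          unfolding A_def by (metis sorted_list_of_set.idem_if_sorted_distinct strict_sorted_iff)
        have "distinct (map ((!) hs) ps)" using \<open>sorted_wrt (<) (map ((!) hs) ps)\<close> strict_sorted_iff by blast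
        then have "card A = r" unfolding A_def using ps(3) distinct_card by fastforce
        moreover have "A \<subseteq> H" unfolding A_def using psX le hs(2) by (fastforce intro: nth_mem)
        ultimately have AH: "A \<in> nsets H r" by (simp add: nsets_def A_def)
        have "F A w = \<chi> ((\<lambda>k. copy (w ! k) (map ((!) hs) ps ! k)) ` {..<r})"
          using wWd by (simp add: F_def A)
        also have "(\<lambda>k. copy (w ! k) (map ((!) hs) ps ! k)) ` {..<r} = (\<lambda>k. R (ps ! k)) ` {..<r}"
          using ps(3) by (intro image_cong) (auto simp: R_def w_def)
        also have "\<dots> = R ` ((!) ps ` {..<r})" by (simp add: image_image)
        also have "(!) ps ` {..<r} = P" using ps(2,3) nth_image[of r ps] by (simp add: atLeast0LessThan)
        finally have "\<chi> e = F A w" unfolding P(2) by (rule sym)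
        then show ?thesis using AH unfolding w by blast
      qed
      show "homogeneous r X S \<chi>"
        unfolding homogeneous_def using key F_eq by metis
    qed
  qed
qed

text \<open>Greedy colouring: the new vertex has at most \<open>D\<close> coloured neighbours, which
  leaves one of the \<open>D + 1\<close> colours.\<close>

lemma bounded_degree_colouring:
  assumes "finite V" and sym: "\<And>x y. R x y \<Longrightarrow> R y x"
    and "\<And>x. x \<in> V \<Longrightarrow> card {y \<in> V. R x y} \<le> D"
  shows "\<exists>\<phi> :: 'a \<Rightarrow> nat. (\<forall>x. \<phi> x \<le> D) \<and> (\<forall>x\<in>V. \<forall>y\<in>V. x \<noteq> y \<longrightarrow> R x y \<longrightarrow> \<phi> x \<noteq> \<phi> y)"
  using assms(1,3)
proof (induction V rule: finite_induct)
  case empty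
  then show ?case by auto
next
  case (insert v V)
  have "card {y \<in> V. R x y} \<le> D" if "x \<in> V" for x
  proof -
    have "card {y \<in> V. R x y} \<le> card {y \<in> insert v V. R x y}"
      using insert.hyps by (intro card_mono) auto
    then show ?thesis using insert.prems[of x] that by simp
  qed
  then obtain \<phi> :: "'a \<Rightarrow> nat" where \<phi>: "\<forall>x. \<phi> x \<le> D" "\<forall>x\<in>V. \<forall>y\<in>V. x \<noteq> y \<longrightarrow> R x y \<longrightarrow> \<phi> x \<noteq> \<phi> y"
    using insert.IH by blast
  let ?N = "{y \<in> V. R v y}"
  have "card (\<phi> ` ?N) \<le> card ?N" using insert.hyps by (intro card_image_le) auto
  also have "\<dots> \<le> card {y \<in> insert v V. R v y}"
    using insert.hyps by (intro card_mono) auto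
  also have "\<dots> \<le> D" using insert.prems by simp
  finally have "card (\<phi> ` ?N) < card {..D}" by simp
  then have "\<not> {..D} \<subseteq> \<phi> ` ?N"
    using insert.hyps card_mono[of "\<phi> ` ?N" "{..D}"] by auto
  then obtain c where c: "c \<le> D" "c \<notin> \<phi> ` ?N" by auto
  show ?case
    using \<phi> c insert.hyps by (intro exI[of _ "\<phi>(v := c)"]) (auto simp: image_iff dest: sym)
qed

text \<open>Balls in one colour class of \<open>\<phi>\<close> are disjoint, so all of them can be
  made homogeneous at the same time, and homogeneity survives the thinning for later classes. Hence
  \<open>K\<close> depends on the number of classes but not on the size of \<open>V\<close>.\<close>

lemma homogeneous_copies_exist_everywhere:
  fixes r s m M k :: nat
  shows "\<exists>K. \<forall>(V :: 'v set) ball \<phi> (T :: 'v \<Rightarrow> nat set) \<chi>.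
    (\<forall>z\<in>V. finite (ball z) \<and> card (ball z) \<le> M) \<longrightarrow>
    (\<forall>z\<in>V. \<forall>z'\<in>V. z \<noteq> z' \<longrightarrow> ball z \<inter> ball z' \<noteq> {} \<longrightarrow> \<phi> z \<noteq> \<phi> z') \<longrightarrow>
    (\<forall>x. finite (T x) \<and> K \<le> card (T x)) \<longrightarrow> (\<forall>e. \<chi> e < s) \<longrightarrow>
    (\<exists>S. (\<forall>x. S x \<subseteq> T x \<and> card (S x) = m) \<and> (\<forall>z\<in>V. \<phi> z < k \<longrightarrow> homogeneous r (ball z) S \<chi>))"
proof (induction k arbitrary: m)
  case 0
  show ?case
  proof (intro exI[of _ m] allI impI)
    fix T :: "'v \<Rightarrow> nat set" and V :: "'v set" and \<phi> :: "'v \<Rightarrow> nat" and ball :: "'v \<Rightarrow> 'v set" and \<chi> :: "('v \<times> nat) set \<Rightarrow> nat"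
    assume "\<forall>x. finite (T x) \<and> m \<le> card (T x)"
    then have "\<forall>x. \<exists>S. S \<subseteq> T x \<and> card S = m" by (meson obtain_subset_with_card_n)
    then show "\<exists>S. (\<forall>x. S x \<subseteq> T x \<and> card (S x) = m) \<and> (\<forall>z\<in>V. \<phi> z < 0 \<longrightarrow> homogeneous r (ball z) S \<chi>)"
      by (metis not_less_zero)
  qed
next
  case (Suc k)
  obtain K1 where K1: "\<forall>(X :: 'v set) (T :: 'v \<Rightarrow> nat set) \<chi>. finite X \<longrightarrow> card X \<le> M \<longrightarrow>
    (\<forall>x\<in>X. finite (T x) \<and> K1 \<le> card (T x)) \<longrightarrow> (\<forall>e. \<chi> e < s) \<longrightarrow>
    (\<exists>S. (\<forall>x\<in>X. S x \<subseteq> T x \<and> card (S x) = m) \<and> homogeneous r X S \<chi>)"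
    using homogeneous_copies_exist[of M s m r] by (elim exE) (rule that)
  \<comment> \<open>The earlier classes leave \<open>K1\<close> copies for the current class and at
    least \<open>m\<close> for vertices outside its balls.\<close>
  obtain K where K: "\<forall>(V :: 'v set) ball \<phi> (T :: 'v \<Rightarrow> nat set) \<chi>.
    (\<forall>z\<in>V. finite (ball z) \<and> card (ball z) \<le> M) \<longrightarrow>
    (\<forall>z\<in>V. \<forall>z'\<in>V. z \<noteq> z' \<longrightarrow> ball z \<inter> ball z' \<noteq> {} \<longrightarrow> \<phi> z \<noteq> \<phi> z') \<longrightarrow>
    (\<forall>x. finite (T x) \<and> K \<le> card (T x)) \<longrightarrow> (\<forall>e. \<chi> e < s) \<longrightarrow>
    (\<exists>S. (\<forall>x. S x \<subseteq> T x \<and> card (S x) = max K1 m) \<and>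
      (\<forall>z\<in>V. \<phi> z < k \<longrightarrow> homogeneous r (ball z) S \<chi>))"
    using Suc.IH[of "max K1 m"] by (elim exE) (rule that)
  show ?case
  proof (intro exI[of _ K] allI impI)
    fix V :: "'v set" and ball :: "'v \<Rightarrow> 'v set" and \<phi> :: "'v \<Rightarrow> nat" and T :: "'v \<Rightarrow> nat set"
      and \<chi> :: "('v \<times> nat) set \<Rightarrow> nat"
    assume ball: "\<forall>z\<in>V. finite (ball z) \<and> card (ball z) \<le> M"
      and \<phi>: "\<forall>z\<in>V. \<forall>z'\<in>V. z \<noteq> z' \<longrightarrow> ball z \<inter> ball z' \<noteq> {} \<longrightarrow> \<phi> z \<noteq> \<phi> z'"
      and T: "\<forall>x. finite (T x) \<and> K \<le> card (T x)" and \<chi>: "\<forall>e. \<chi> e < s"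
    obtain S0 where S0: "\<And>x. S0 x \<subseteq> T x" "\<And>x. card (S0 x) = max K1 m"
      "\<And>z. z \<in> V \<Longrightarrow> \<phi> z < k \<Longrightarrow> homogeneous r (ball z) S0 \<chi>"
      using K[rule_format, of V ball \<phi> T \<chi>] ball \<phi> T \<chi> by metis
    have finS0: "finite (S0 x)" for x using S0(1) T finite_subset by blast
    have "\<exists>S. (\<forall>x\<in>ball z. S x \<subseteq> S0 x \<and> card (S x) = m) \<and> homogeneous r (ball z) S \<chi>" if "z \<in> V" for z
      using ball that finS0 S0(2) \<chi> by (intro K1[rule_format]) auto
    then obtain S1 where S1: "\<And>z x. z \<in> V \<Longrightarrow> x \<in> ball z \<Longrightarrow> S1 z x \<subseteq> S0 x \<and> card (S1 z x) = m"
      "\<And>z. z \<in> V \<Longrightarrow> homogeneous r (ball z) (S1 z) \<chi>" by metis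
    have "\<forall>x. \<exists>S. S \<subseteq> S0 x \<and> card S = m"
      using S0(2) by (metis max.cobounded2 obtain_subset_with_card_n)
    then obtain S2 where S2: "\<And>x. S2 x \<subseteq> S0 x \<and> card (S2 x) = m" by metis
    \<comment> \<open>The only centre of colour \<open>k\<close> whose ball may determine the copies
      of \<open>x\<close>.\<close>
    define home where "home x z \<longleftrightarrow> z \<in> V \<and> \<phi> z = k \<and> x \<in> ball z" for x z
    have unique: "z = z'" if "home x z" "home x z'" for x z z'
      using that \<phi>[rule_format, of z z'] unfolding home_def by auto
    define S where "S x = (if \<exists>z. home x z then S1 (THE z. home x z) x else S2 x)" for x
    have S_home: "S x = S1 z x" if "home x z" for x z
    proof -
      have "(THE z. home x z) = z" using that unique by blast
      then show ?thesis using that by (auto simp: S_def)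
    qed
    have S: "S x \<subseteq> S0 x \<and> card (S x) = m" for x
    proof (cases "\<exists>z. home x z")
      case True
      then obtain z where z: "home x z" by blast
      then show ?thesis using S_home[OF z] S1(1)[of z x] by (simp add: home_def)
    next
      case False
      then show ?thesis using S2 by (simp add: S_def)
    qed
    have "homogeneous r (ball z) S \<chi>" if z: "z \<in> V" "\<phi> z < Suc k" for z
    proof (cases "\<phi> z = k")
      case True
      then show ?thesis
        using homogeneous_mono[OF S1(2)[OF z(1)], of S] S_home[of _ z] z(1) by (simp add: home_def)
    next
      case False
      then show ?thesis using homogeneous_mono[OF S0(3)[OF z(1)], of S] S z(2) by simp
    qed
    moreover have "S x \<subseteq> T x \<and> card (S x) = m" for x using S[of x] S0(1)[of x] by blast
    ultimately show "\<exists>S. (\<forall>x. S x \<subseteq> T x \<and> card (S x) = m) \<and>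
        (\<forall>z\<in>V. \<phi> z < Suc k \<longrightarrow> homogeneous r (ball z) S \<chi>)" by blast
  qed
qed

subsection \<open>The host hypergraph\<close>

lemma card_reach:
  assumes "\<And>x. x \<in> V \<Longrightarrow> nb x \<subseteq> V \<and> finite (nb x) \<and> card (nb x) \<le> \<Delta>" and "x \<in> V"
  shows "finite (reach nb k x) \<and> card (reach nb k x) \<le> Suc \<Delta> ^ k"
  using assms(2)
proof (induction k arbitrary: x)
  case (Suc k)
  have nb: "finite (nb x)" "card (nb x) \<le> \<Delta>" and IH: "finite (reach nb k v)" "card (reach nb k v) \<le> Suc \<Delta> ^ k"
    if "v \<in> nb x" for v using assms(1)[OF Suc.prems] Suc.IH that by blast+
  have fin: "finite (nb x)" "card (nb x) \<le> \<Delta>" using assms(1)[OF Suc.prems] by auto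
  have "card (\<Union>v\<in>nb x. reach nb k v) \<le> (\<Sum>v\<in>nb x. card (reach nb k v))"
    using fin by (intro card_UN_le)
  also have "\<dots> \<le> card (nb x) * Suc \<Delta> ^ k"
    using sum_bounded_above[of "nb x" "\<lambda>v. card (reach nb k v)"] IH by simp
  also have "\<dots> \<le> \<Delta> * Suc \<Delta> ^ k" using fin by simp
  finally have "card (reach nb (Suc k) x) \<le> Suc (\<Delta> * Suc \<Delta> ^ k)"
    using fin IH by (simp add: card_insert_if)
  also have "\<dots> \<le> Suc \<Delta> ^ Suc k" by simp
  finally show ?case using fin IH by simp
qed auto

text \<open>Counterpart of the bound on balls, using in-degrees: it limits the number of balls
  through a vertex.\<close>

lemma card_reached_from:
  assumes "finite V" and "\<And>x. x \<in> V \<Longrightarrow> nb x \<subseteq> V \<and> card {z \<in> V. x \<in> nb z} \<le> \<Delta>" and "y \<in> V"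
  shows "card {z \<in> V. y \<in> reach nb k z} \<le> Suc \<Delta> ^ k"
proof (induction k)
  case 0
  have "{z \<in> V. y \<in> reach nb 0 z} \<subseteq> {y}" by auto
  then show ?case using card_mono[of "{y}"] by fastforce
next
  case (Suc k)
  let ?A = "{v \<in> V. y \<in> reach nb k v}"
  have "{z \<in> V. y \<in> reach nb (Suc k) z} \<subseteq> insert y (\<Union>v\<in>?A. {z \<in> V. v \<in> nb z})"
    using assms(2) by fastforce
  then have "card {z \<in> V. y \<in> reach nb (Suc k) z} \<le> card (insert y (\<Union>v\<in>?A. {z \<in> V. v \<in> nb z}))"
    using assms(1) by (intro card_mono) auto
  also have "\<dots> \<le> Suc (card (\<Union>v\<in>?A. {z \<in> V. v \<in> nb z}))"
    using assms(1) by (simp add: card_insert_if)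
  finally have "card {z \<in> V. y \<in> reach nb (Suc k) z} \<le> Suc (card (\<Union>v\<in>?A. {z \<in> V. v \<in> nb z}))" .
  moreover have "card (\<Union>v\<in>?A. {z \<in> V. v \<in> nb z}) \<le> Suc \<Delta> ^ k * \<Delta>"
  proof -
    have "card (\<Union>v\<in>?A. {z \<in> V. v \<in> nb z}) \<le> (\<Sum>v\<in>?A. card {z \<in> V. v \<in> nb z})"
      using assms(1) by (intro card_UN_le) auto
    also have "\<dots> \<le> card ?A * \<Delta>"
      using sum_bounded_above[of ?A "\<lambda>v. card {z \<in> V. v \<in> nb z}" \<Delta>] assms(2) by simp
    also have "\<dots> \<le> Suc \<Delta> ^ k * \<Delta>" using Suc.IH by (rule mult_right_mono) simp
    finally show ?thesis .
  qed
  moreover have "Suc (Suc \<Delta> ^ k * \<Delta>) \<le> Suc \<Delta> ^ Suc k" by simp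
  ultimately show ?case by linarith
qed

section \<open>Concatenating gadgets along a path in the link graph\<close>

definition near :: "'v set \<Rightarrow> ('v \<Rightarrow> 'v set) \<Rightarrow> 'v \<Rightarrow> 'v \<Rightarrow> bool" where
  "near V ball y x \<longleftrightarrow> (\<exists>z\<in>V. y \<in> ball z \<and> x \<in> ball z)"

text \<open>Besides having the colour, a window must lie in one ball, since only such
  \<open>r\<close>-sets are edges of the host.\<close>

definition local_window :: "'v set \<Rightarrow> ('v \<Rightarrow> 'v set) \<Rightarrow> ('v multiset \<Rightarrow> nat) \<Rightarrow> nat \<Rightarrow> 'v list \<Rightarrow> bool" where
  "local_window V ball col c w \<longleftrightarrow> col (mset w) = c \<and> (\<exists>z\<in>V. set w \<subseteq> ball z)"

text \<open>A link contributes the segment \<open>g u @ U\<close>. Its \<open>2 * r\<close> entries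
  lie in a ball containing \<open>u\<close>, so visits to \<open>y\<close> can be charged to path
  vertices near \<open>y\<close>.\<close>

lemma linkedE:
  assumes "linked V ball r col c g u v"
  obtains U where "length U = r" and "length (g u) = r" and "length (g v) = r"
    and "all_windows r (local_window V ball col c) (g u @ U)"
    and "all_windows r (local_window V ball col c) (U @ g v)"
    and "set (g u @ U @ g v) \<subseteq> (\<Union>z\<in>V. ball z)"
    and "\<And>y. count_list (g u @ U) y \<le> 2 * r * of_bool (near V ball y u)"
    and "\<And>y. count_list (g v) y \<le> 2 * r * of_bool (near V ball y v)"
proof -
  obtain z U where z: "z \<in> V" and len: "length U = r" "length (g u) = r" "length (g v) = r"
    and ball: "u \<in> ball z" "v \<in> ball z" "set U \<subseteq> ball z" "set (g u) \<subseteq> ball z" "set (g v) \<subseteq> ball z"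
    and win: "all_windows r (\<lambda>w. col (mset w) = c) (g u @ U)" "all_windows r (\<lambda>w. col (mset w) = c) (U @ g v)"
    using assms unfolding linked_def by auto
  have local: "all_windows r (local_window V ball col c) l"
    if "all_windows r (\<lambda>w. col (mset w) = c) l" "set l \<subseteq> ball z" for l
    using that z by (elim all_windows_mono) (auto simp: local_window_def)
  have count: "count_list l y \<le> 2 * r * of_bool (near V ball y x)"
    if "set l \<subseteq> ball z" "length l \<le> 2 * r" "x \<in> ball z" for l y x
  proof (cases "y \<in> set l")
    case True
    then have "near V ball y x" using that z by (auto simp: near_def)
    then show ?thesis using count_le_length[of l y] that by simp
  qed (simp add: count_list_0_iff)
  show thesis
  proof (rule that[OF len])
    show "all_windows r (local_window V ball col c) (g u @ U)"
      using ball by (intro local win) simp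
    show "all_windows r (local_window V ball col c) (U @ g v)"
      using ball by (intro local win) simp
    show "set (g u @ U @ g v) \<subseteq> (\<Union>z\<in>V. ball z)" using ball z by auto
    show "count_list (g u @ U) y \<le> 2 * r * of_bool (near V ball y u)" for y
      using ball len by (intro count) auto
    show "count_list (g v) y \<le> 2 * r * of_bool (near V ball y v)" for y
      using ball len by (intro count) auto
  qed
qed

text \<open>The list alternates gadgets and middle segments; consecutive pieces glue because all of
  them have length \<open>r\<close>, and \<open>take r l = g u\<close> is what the next gluing
  needs. As path vertices are distinct and each is charged at most \<open>2 * r\<close> visits, the
  visits are bounded by a cardinality.\<close>

lemma linked_path_concat:
  assumes "distinct (u # v # p)" and "successively (linked V ball r col c g) (u # v # p)"
  shows "\<exists>l. all_windows r (local_window V ball col c) l \<and> take r l = g u \<and> r * length (v # p) \<le> length l \<and>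
    set l \<subseteq> (\<Union>z\<in>V. ball z) \<and>
    (\<forall>y. count_list l y \<le> 2 * r * card {x \<in> set (u # v # p). near V ball y x})"
  using assms
proof (induction p arbitrary: u v)
  case Nil
  then have "linked V ball r col c g u v" by simp
  then obtain U where U: "length U = r" "length (g u) = r" "length (g v) = r"
    "all_windows r (local_window V ball col c) (g u @ U)"
    "all_windows r (local_window V ball col c) (U @ g v)"
    "set (g u @ U @ g v) \<subseteq> (\<Union>z\<in>V. ball z)"
    and count: "\<And>y. count_list (g u @ U) y \<le> 2 * r * of_bool (near V ball y u)"
      "\<And>y. count_list (g v) y \<le> 2 * r * of_bool (near V ball y v)"
    by (rule linkedE) blast
  have "count_list (g u @ U @ g v) y \<le> 2 * r * card {x \<in> set [u, v]. near V ball y x}" for y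
  proof -
    have "{x \<in> set [u, v]. near V ball y x} =
        (if near V ball y u then {u} else {}) \<union> (if near V ball y v then {v} else {})" by auto
    then have "card {x \<in> set [u, v]. near V ball y x} = of_bool (near V ball y u) + of_bool (near V ball y v)"
      using Nil.prems(1) by simp
    then show ?thesis using count[of y] by (simp add: distrib_left)
  qed
  moreover have "all_windows r (local_window V ball col c) (g u @ U @ g v)"
    using U by (intro all_windows_append) auto
  ultimately show ?case using U by (intro exI[of _ "g u @ U @ g v"]) auto
next
  case (Cons w p)
  then have "linked V ball r col c g u v" by simp
  then obtain U where U: "length U = r" "length (g u) = r" "length (g v) = r"
    "all_windows r (local_window V ball col c) (g u @ U)"
    "all_windows r (local_window V ball col c) (U @ g v)"
    "set (g u @ U @ g v) \<subseteq> (\<Union>z\<in>V. ball z)"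
    and count: "\<And>y. count_list (g u @ U) y \<le> 2 * r * of_bool (near V ball y u)"
    by (rule linkedE) blast
  obtain l where l: "all_windows r (local_window V ball col c) l" "take r l = g v"
    "r * length (w # p) \<le> length l" "set l \<subseteq> (\<Union>z\<in>V. ball z)"
    "\<And>y. count_list l y \<le> 2 * r * card {x \<in> set (v # w # p). near V ball y x}"
    using Cons.IH[of v w] Cons.prems by auto
  have l_eq: "l = g v @ drop r l" using l(2) append_take_drop_id[of r l] by simp
  have "all_windows r (local_window V ball col c) (U @ g v @ drop r l)"
    using U l(1) l_eq by (intro all_windows_append) auto
  then have "all_windows r (local_window V ball col c) (g u @ U @ l)"
    using U l_eq by (intro all_windows_append) auto
  moreover have "count_list (g u @ U @ l) y \<le> 2 * r * card {x \<in> set (u # v # w # p). near V ball y x}" for y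
  proof -
    define A where "A = {x \<in> set (v # w # p). near V ball y x}"
    have "{x \<in> set (u # v # w # p). near V ball y x} = (if near V ball y u then insert u A else A)"
      by (auto simp: A_def)
    moreover have "finite A" "u \<notin> A" using Cons.prems(1) by (auto simp: A_def)
    ultimately have "card {x \<in> set (u # v # w # p). near V ball y x} = of_bool (near V ball y u) + card A"
      by simp
    then show ?thesis using count[of y] l(5)[of y, folded A_def] by (simp add: distrib_left)
  qed
  ultimately show ?case using U l by (intro exI[of _ "g u @ U @ l"]) auto
qed

lemma ramsey_hypergraph:
  fixes r s k :: nat
  shows "\<exists>D. \<forall>f :: nat set \<Rightarrow> nat. (\<forall>e. e \<subseteq> {..D} \<longrightarrow> card e = r \<longrightarrow> f e < s) \<longrightarrow>
    (\<exists>H c. H \<subseteq> {..D} \<and> card H = k \<and> c < s \<and> (\<forall>e. e \<subseteq> H \<longrightarrow> card e = r \<longrightarrow> f e = c))"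
proof -
  obtain N :: nat where "partn_lst {..<N} (replicate s k) r" using ramsey_full by blast
  then have N: "partn_lst {..<Suc N} (replicate s k) r" by (rule partn_lst_greater_resource) simp
  show ?thesis
  proof (intro exI[of _ N] allI impI)
    fix f :: "nat set \<Rightarrow> nat"
    assume f: "\<forall>e. e \<subseteq> {..N} \<longrightarrow> card e = r \<longrightarrow> f e < s"
    have "f \<in> nsets {..<Suc N} r \<rightarrow> {..<s}" using f by (auto simp: nsets_def lessThan_Suc_atMost)
    then obtain c H where c: "c < s" and H: "H \<in> nsets {..<Suc N} k" "f ` nsets H r \<subseteq> {c}"
      by (rule partn_lstE[OF N]) auto
    have "f e = c" if "e \<subseteq> H" "card e = r" for e
    proof -
      have "finite e" using that H(1) finite_subset by (auto simp: nsets_def)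
      then have "e \<in> nsets H r" using that by (simp add: nsets_def)
      then show ?thesis using H(2) by blast
    qed
    then show "\<exists>H c. H \<subseteq> {..N} \<and> card H = k \<and> c < s \<and> (\<forall>e. e \<subseteq> H \<longrightarrow> card e = r \<longrightarrow> f e = c)"
      using c H(1) by (intro exI[of _ H] exI[of _ c]) (auto simp: nsets_def lessThan_Suc_atMost)
  qed
qed

text \<open>The \<open>k\<close>-th occurrence of \<open>x\<close> in the list is replaced by the \<open>k\<close>-th copy of \<open>x\<close>.\<close>

lemma distinct_copies:
  fixes l :: "'v list" and S :: "'v \<Rightarrow> 'k set"
  assumes "\<And>x. finite (S x)" and "\<And>x. count_list l x \<le> card (S x)"
  shows "\<exists>h. inj_on h {..<length l} \<and> (\<forall>i<length l. fst (h i) = l ! i \<and> snd (h i) \<in> S (l ! i))"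
proof -
  have "\<exists>\<sigma>. bij_betw \<sigma> {..<card (S x)} (S x)" for x
    using ex_bij_betw_nat_finite[OF assms(1)] by (auto simp: atLeast0LessThan)
  then obtain \<sigma> where \<sigma>: "\<And>x. bij_betw (\<sigma> x) {..<card (S x)} (S x)" by metis
  define occ where "occ i = count_list (take i l) (l ! i)" for i
  have occ: "count_list (take i l) (l ! i) < count_list (take j l) (l ! i)"
    if "i < j" "j \<le> length l" for i j
  proof -
    have "take j l = take (Suc i) l @ take (j - Suc i) (drop (Suc i) l)"
      using that take_add[of "Suc i" "j - Suc i" l] by simp
    then show ?thesis using that by (simp add: take_Suc_conv_app_nth)
  qed
  have less: "occ i < card (S (l ! i))" if "i < length l" for i
    using occ[OF that order_refl] assms(2)[of "l ! i"] by (simp add: occ_def)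
  define h where "h i = (l ! i, \<sigma> (l ! i) (occ i))" for i
  have "inj_on h {..<length l}"
  proof (rule linorder_inj_onI')
    fix i j assume ij: "i \<in> {..<length l}" "j \<in> {..<length l}" "i < j"
    show "h i \<noteq> h j"
    proof
      assume eq: "h i = h j"
      then have x: "l ! i = l ! j" by (simp add: h_def)
      then have "occ i = occ j"
        using eq less[of i] less[of j] ij inj_onD[OF bij_betw_imp_inj_on[OF \<sigma>[of "l ! j"]]]
        by (simp add: h_def)
      then show False using occ[OF ij(3)] ij(2) x by (simp add: occ_def)
    qed
  qed
  moreover have "snd (h i) \<in> S (l ! i)" if "i < length l" for i
    using \<sigma>[of "l ! i"] less[OF that] by (auto simp: h_def bij_betw_def)
  ultimately show ?thesis by (intro exI[of _ h]) (auto simp: h_def)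
qed

lemma monochromatic_copyI:
  assumes inj: "inj_on h {1..n}" and verts: "h ` {1..n} \<subseteq> verts G"
    and edges: "\<And>i. 1 \<le> i \<Longrightarrow> i + r \<le> Suc n \<Longrightarrow> h ` {i..<i + r} \<in> edges G \<and> c (h ` {i..<i + r}) = k"
    and "r \<ge> 1"
  shows "monochromatic_copy c G (tight_path r n)"
proof -
  have e: "h ` e \<in> edges G \<and> c (h ` e) = k" if path_edge: "e \<in> edges (tight_path r n)" for e
  proof -
    obtain i where i: "e = {i..<i + r}" "{i..<i + r} \<subseteq> {1..n}"
      using path_edge by (auto simp: tight_path_def)
    \<comment> \<open>\<open>r \<ge> 1\<close> makes the edge nonempty, so that its ends confine
      \<open>i\<close>.\<close>
    then have "i \<in> {1..n}" "i + r - 1 \<in> {1..n}" using \<open>r \<ge> 1\<close> by (auto simp: subset_iff)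
    then show ?thesis using edges[of i] i(1) by auto
  qed
  let ?H = "\<lparr>verts = h ` {1..n}, edges = (`) h ` edges (tight_path r n)\<rparr>"
  have "subhypergraph ?H G"
    unfolding subhypergraph_def using verts e by (auto simp: tight_path_def)
  moreover have "hypergraph_iso (tight_path r n) ?H"
    unfolding hypergraph_iso_def using inj
    by (intro exI[of _ h]) (auto simp: bij_betw_def tight_path_def)
  moreover have "\<forall>e\<in>edges ?H. c e = k" using e by auto
  ultimately show ?thesis unfolding monochromatic_copy_def by blast
qed

text \<open>
  \<open>\<Delta>\<close> is chosen after \<open>D\<close> and \<open>B\<close>, and the number \<open>K\<close> of copies of each vertex last, since \<open>K\<close>
  depends on how often the concatenated path may revisit a vertex, hence on \<open>\<Delta>\<close>.
\<close>

lemma tight_path_host: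
  fixes r s :: nat
  assumes r: "r \<ge> 1" and s: "s \<ge> 1"
  shows "\<exists>C. \<forall>n\<ge>1. \<exists>G :: nat hypergraph. finite_hypergraph G \<and> arrows G s (tight_path r n) \<and>
    card (edges G) \<le> C * n"
proof -
  obtain D where ramsey: "\<forall>f :: nat set \<Rightarrow> nat. (\<forall>e. e \<subseteq> {..D} \<longrightarrow> card e = r \<longrightarrow> f e < s) \<longrightarrow>
    (\<exists>H c. H \<subseteq> {..D} \<and> card H = 2 * r \<and> c < s \<and> (\<forall>e. e \<subseteq> H \<longrightarrow> card e = r \<longrightarrow> f e = c))"
    using ramsey_hypergraph[of r s "2 * r"] by (elim exE) (rule that)
  define B where "B = Suc (2 ^ Suc D * s)"
  define a where "a = 4 * B * 2 ^ (B ^ D * 2 ^ Suc D * s * (B * B))"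
  have "a \<ge> 1" by (simp add: a_def B_def Suc_le_eq)
  obtain \<Delta> where expander: "\<forall>n\<ge>1. \<exists>(V :: nat set) nb. finite V \<and> card V = a * n \<and>
    (\<forall>x\<in>V. nb x \<subseteq> V \<and> card (nb x) \<le> \<Delta> \<and> card {z \<in> V. x \<in> nb z} \<le> \<Delta>) \<and>
    (\<forall>X Y. X \<subseteq> V \<longrightarrow> Y \<subseteq> V \<longrightarrow> n \<le> card X \<longrightarrow> n \<le> card Y \<longrightarrow> (\<exists>x\<in>X. nb x \<inter> Y \<noteq> {}))"
    using sparse_expander_exists[OF \<open>a \<ge> 1\<close>] by (elim exE) (rule that)
  \<comment> \<open>\<open>M\<close> bounds both the size of a ball and the number of balls through
    a vertex. So at most \<open>M * M\<close> vertices are near a given one, each charged at most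
    \<open>2 * r\<close> visits, which gives \<open>m\<close>.\<close>
  define M where "M = Suc \<Delta> ^ D"
  define m where "m = 2 * r * (M * M)"
  obtain K where K: "\<forall>(V :: nat set) ball \<phi> (T :: nat \<Rightarrow> nat set) \<chi>.
    (\<forall>z\<in>V. finite (ball z) \<and> card (ball z) \<le> M) \<longrightarrow>
    (\<forall>z\<in>V. \<forall>z'\<in>V. z \<noteq> z' \<longrightarrow> ball z \<inter> ball z' \<noteq> {} \<longrightarrow> \<phi> z \<noteq> \<phi> z') \<longrightarrow>
    (\<forall>x. finite (T x) \<and> K \<le> card (T x)) \<longrightarrow> (\<forall>e. \<chi> e < s) \<longrightarrow>
    (\<exists>S. (\<forall>x. S x \<subseteq> T x \<and> card (S x) = m) \<and>
      (\<forall>z\<in>V. \<phi> z < Suc (M * M) \<longrightarrow> homogeneous r (ball z) S \<chi>))"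
    using homogeneous_copies_exist_everywhere[of M s m "Suc (M * M)" r] by (elim exE) (rule that)
  have "\<exists>G :: nat hypergraph. finite_hypergraph G \<and> arrows G s (tight_path r n) \<and>
    card (edges G) \<le> a * 2 ^ (M * K) * n" if n: "n \<ge> 1" for n
  proof -
    obtain V :: "nat set" and nb where V: "finite V" "card V = a * n"
      and nb_all: "\<forall>x\<in>V. nb x \<subseteq> V \<and> card (nb x) \<le> \<Delta> \<and> card {z \<in> V. x \<in> nb z} \<le> \<Delta>"
      and exp_all: "\<forall>X Y. X \<subseteq> V \<longrightarrow> Y \<subseteq> V \<longrightarrow> n \<le> card X \<longrightarrow> n \<le> card Y \<longrightarrow> (\<exists>x\<in>X. nb x \<inter> Y \<noteq> {})"
      using expander[rule_format, OF n] by (elim exE conjE) (rule that)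
    have nb: "nb x \<subseteq> V" "card (nb x) \<le> \<Delta>" "card {z \<in> V. x \<in> nb z} \<le> \<Delta>" if "x \<in> V" for x
      using nb_all that by auto
    have expanding: "\<exists>x\<in>X. nb x \<inter> Y \<noteq> {}" if "X \<subseteq> V" "Y \<subseteq> V" "n \<le> card X" "n \<le> card Y" for X Y
      using exp_all that by simp
    define ball where "ball = reach nb D"
    have ballV: "ball z \<subseteq> V" if "z \<in> V" for z
      unfolding ball_def using nb(1) that by (rule reach_subset)
    have finite_nb: "finite (nb x)" if "x \<in> V" for x using nb(1)[OF that] V(1) by (rule finite_subset)
    have card_ball: "finite (ball z)" "card (ball z) \<le> M" if "z \<in> V" for z
      using card_reach[of V nb \<Delta> z D] nb finite_nb that by (simp_all add: ball_def M_def)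
    have card_in: "card {z \<in> V. y \<in> ball z} \<le> M" if "y \<in> V" for y
      unfolding ball_def M_def using V(1) nb that by (intro card_reached_from) auto
    have two_steps: "card (\<Union>z\<in>{z \<in> V. y \<in> ball z}. ball z) \<le> M * M" if "y \<in> V" for y
    proof -
      have "card (\<Union>z\<in>{z \<in> V. y \<in> ball z}. ball z) \<le> (\<Sum>z\<in>{z \<in> V. y \<in> ball z}. card (ball z))"
        using V(1) by (intro card_UN_le) auto
      also have "\<dots> \<le> card {z \<in> V. y \<in> ball z} * M"
        using sum_bounded_above[of "{z \<in> V. y \<in> ball z}" "\<lambda>z. card (ball z)" M] card_ball by simp
      also have "\<dots> \<le> M * M" using card_in[OF that] by simp
      finally show ?thesis .
    qed
    have card_near: "card {x \<in> A. near V ball y x} \<le> M * M" if "y \<in> V" for y A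
    proof -
      have "{x \<in> A. near V ball y x} \<subseteq> (\<Union>z\<in>{z \<in> V. y \<in> ball z}. ball z)" by (auto simp: near_def)
      moreover have "finite (\<Union>z\<in>{z \<in> V. y \<in> ball z}. ball z)" using V(1) card_ball by auto
      ultimately show ?thesis using two_steps[OF that] card_mono le_trans by blast
    qed
    have "card {z' \<in> V. ball z \<inter> ball z' \<noteq> {}} \<le> M * M" if z: "z \<in> V" for z
    proof -
      have "{z' \<in> V. ball z \<inter> ball z' \<noteq> {}} = (\<Union>y\<in>ball z. {z' \<in> V. y \<in> ball z'})" by auto
      then have "card {z' \<in> V. ball z \<inter> ball z' \<noteq> {}} \<le> (\<Sum>y\<in>ball z. card {z' \<in> V. y \<in> ball z'})"
        using card_ball(1)[OF z] by (simp add: card_UN_le)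
      also have "\<dots> \<le> card (ball z) * M"
        using sum_bounded_above[of "ball z" "\<lambda>y. card {z' \<in> V. y \<in> ball z'}" M] card_in ballV[OF z] by auto
      also have "\<dots> \<le> M * M" using card_ball(2)[OF z] by simp
      finally show ?thesis .
    qed
    \<comment> \<open>\<open>M * M + 1\<close> rounds, a number independent of \<open>n\<close>,
      then suffice to make all balls homogeneous.\<close>
    then have "\<exists>\<phi> :: nat \<Rightarrow> nat. (\<forall>z. \<phi> z \<le> M * M) \<and>
        (\<forall>z\<in>V. \<forall>z'\<in>V. z \<noteq> z' \<longrightarrow> ball z \<inter> ball z' \<noteq> {} \<longrightarrow> \<phi> z \<noteq> \<phi> z')"
      using V(1) by (intro bounded_degree_colouring) auto
    then obtain \<phi> :: "nat \<Rightarrow> nat" where \<phi>: "\<And>z. \<phi> z < Suc (M * M)"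
      "\<forall>z\<in>V. \<forall>z'\<in>V. z \<noteq> z' \<longrightarrow> ball z \<inter> ball z' \<noteq> {} \<longrightarrow> \<phi> z \<noteq> \<phi> z'"
      by (metis less_Suc_eq_le)
    \<comment> \<open>Only \<open>r\<close>-sets over a single ball become edges: each ball gives at
      most \<open>2 ^ (M * K)\<close> of them, so the total is linear in \<open>n\<close>.
      \<open>prod_encode\<close> turns copies into natural numbers.\<close>
    define edges_at where "edges_at z = {e. e \<subseteq> ball z \<times> {..<K} \<and> card e = r}" for z
    define G :: "nat hypergraph" where
      "G = \<lparr>verts = prod_encode ` (V \<times> {..<K}), edges = (\<Union>z\<in>V. (`) prod_encode ` edges_at z)\<rparr>"
    have "finite_hypergraph G"
      unfolding finite_hypergraph_def G_def edges_at_def using V(1) ballV by fastforce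
    moreover have "card (edges G) \<le> a * 2 ^ (M * K) * n"
    proof -
      have "card ((`) prod_encode ` edges_at z) \<le> 2 ^ (M * K)" if z: "z \<in> V" for z
      proof -
        have fin: "finite (Pow (ball z \<times> {..<K}))" using card_ball(1)[OF z] by simp
        have sub: "edges_at z \<subseteq> Pow (ball z \<times> {..<K})" by (auto simp: edges_at_def)
        have "card ((`) prod_encode ` edges_at z) \<le> card (edges_at z)"
          using fin sub finite_subset by (intro card_image_le) blast
        also have "\<dots> \<le> card (Pow (ball z \<times> {..<K}))" using fin sub by (rule card_mono)
        also have "\<dots> = 2 ^ (card (ball z) * K)"
          using card_ball(1)[OF z] by (simp add: card_Pow card_cartesian_product)
        also have "\<dots> \<le> 2 ^ (M * K)" using card_ball(2)[OF z] by (intro power_increasing) auto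
        finally show ?thesis .
      qed
      then have "card (edges G) \<le> card V * 2 ^ (M * K)"
        unfolding G_def using card_UN_le[OF V(1), of "\<lambda>z. (`) prod_encode ` edges_at z"]
          sum_bounded_above[of V "\<lambda>z. card ((`) prod_encode ` edges_at z)" "2 ^ (M * K)"] by simp
      then show ?thesis using V(2) by (simp add: mult_ac)
    qed
    moreover have "arrows G s (tight_path r n)"
      unfolding arrows_def
    proof (intro allI impI)
      fix c :: "nat set \<Rightarrow> nat"
      assume c: "c ` edges G \<subseteq> {..<s}"
      \<comment> \<open>\<open>c\<close> is controlled only on the edges of \<open>G\<close>; the
        default 0, a colour because \<open>s \<ge> 1\<close>, keeps \<open>\<chi>\<close> below
        \<open>s\<close> on all sets.\<close>
      define \<chi> where "\<chi> e = (if c (prod_encode ` e) < s then c (prod_encode ` e) else 0)" for e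
      have \<chi>_less: "\<forall>e. \<chi> e < s" using s by (simp add: \<chi>_def)
      have "\<exists>S. (\<forall>x. S x \<subseteq> {..<K} \<and> card (S x) = m) \<and>
          (\<forall>z\<in>V. \<phi> z < Suc (M * M) \<longrightarrow> homogeneous r (ball z) S \<chi>)"
        using K[rule_format, of V ball \<phi> "\<lambda>_. {..<K}" \<chi>] card_ball \<phi>(2) \<chi>_less by simp
      then obtain S where copies: "\<forall>x. S x \<subseteq> {..<K} \<and> card (S x) = m"
        and hom_all: "\<forall>z\<in>V. \<phi> z < Suc (M * M) \<longrightarrow> homogeneous r (ball z) S \<chi>"
        by (elim exE conjE)
      have S: "S x \<subseteq> {..<K}" "card (S x) = m" for x using copies by auto
      have hom: "homogeneous r (ball z) S \<chi>" if "z \<in> V" for z using hom_all that \<phi>(1) by blast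
      have finS: "finite (S x)" for x using S(1) finite_subset by blast
      define edge_of where "edge_of \<mu> e \<longleftrightarrow> (\<exists>z\<in>V. e \<subseteq> Sigma (ball z) S) \<and> card e = r \<and>
        image_mset fst (mset_set e) = \<mu>" for \<mu> e
      \<comment> \<open>The colour of a multiset is read off an arbitrary edge over it. For a
        multiset inside a ball every such edge lies over that ball, so the choice is immaterial by
        homogeneity. If there is no edge, the value is arbitrary but still less than
        \<open>s\<close>.\<close>
      define col where "col \<mu> = \<chi> (SOME e. edge_of \<mu> e)" for \<mu>
      have col: "col \<mu> = \<chi> e" if e: "edge_of \<mu> e" and z: "z \<in> V" "set_mset \<mu> \<subseteq> ball z" for \<mu> e z
      proof -
        have at_z: "e' \<subseteq> Sigma (ball z) S" if e': "edge_of \<mu> e'" for e'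
        proof -
          obtain z' where z': "z' \<in> V" "e' \<subseteq> Sigma (ball z') S" using e' by (auto simp: edge_of_def)
          have "card e' \<noteq> 0" using e' r by (simp add: edge_of_def)
          then have "finite e'" by (metis card.infinite)
          moreover have "image_mset fst (mset_set e') = \<mu>" using e' by (simp add: edge_of_def)
          ultimately have "set_mset \<mu> = fst ` e'" by (metis finite_set_mset_mset_set set_image_mset)
          then have "x \<in> Sigma (ball z) S" if "x \<in> e'" for x
            using z(2) z'(2) that by (cases x) force
          then show ?thesis by blast
        qed
        have some: "edge_of \<mu> (SOME e. edge_of \<mu> e)" using e by (rule someI)
        show ?thesis
          unfolding col_def
          by (rule hom[OF z(1), unfolded homogeneous_def, rule_format, OF at_z[OF some] at_z[OF e]])
            (use e some in \<open>simp_all add: edge_of_def\<close>)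
      qed
      interpret tower V nb n r s B D col
      proof unfold_locales
        show "col M < s" for M using \<chi>_less by (simp add: col_def)
        show "\<exists>H c. H \<subseteq> {..D} \<and> card H = 2 * r \<and> c < s \<and> (\<forall>e. e \<subseteq> H \<longrightarrow> card e = r \<longrightarrow> f e = c)"
          if "\<And>e. e \<subseteq> {..D} \<Longrightarrow> card e = r \<Longrightarrow> f e < s" for f :: "nat set \<Rightarrow> nat"
          using that by (intro ramsey[rule_format]) blast
      qed (use V nb expanding n r in \<open>auto simp: a_def B_def\<close>)
      obtain k g p where p: "distinct p" "set p \<subseteq> V" "length p = Suc n"
        "successively (linked V ball r col k g) p"
        using long_linked_path unfolding long_linked_path_def ball_def[symmetric]
        by (elim exE conjE) (rule that)
      obtain u v q where uv: "p = u # v # q"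
      proof -
        obtain u p' where "p = u # p'" using p(3) by (cases p) auto
        moreover from this obtain v q where "p' = v # q" using p(3) n by (cases p') auto
        ultimately show ?thesis using that by simp
      qed
      obtain l where l: "all_windows r (local_window V ball col k) l" "r * length (v # q) \<le> length l"
        "set l \<subseteq> (\<Union>z\<in>V. ball z)"
        and count: "\<forall>y. count_list l y \<le> 2 * r * card {x \<in> set (u # v # q). near V ball y x}"
        using linked_path_concat[OF p(1)[unfolded uv] p(4)[unfolded uv]]
        by (elim exE conjE) (rule that)
      have setl: "set l \<subseteq> V" using l(3) ballV by blast
      \<comment> \<open>The \<open>n + 1\<close> path vertices give \<open>n\<close> links, each
        accounting for at least \<open>r\<close> entries.\<close>
      have "n \<le> r * length (v # q)" using p(3) uv r by simp
      then have len: "n \<le> length l" using l(2) by simp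
      have "count_list l y \<le> card (S y)" for y
      proof (cases "y \<in> set l")
        case True
        then have "card {x \<in> set (u # v # q). near V ball y x} \<le> M * M"
          using card_near setl by blast
        then have "2 * r * card {x \<in> set (u # v # q). near V ball y x} \<le> m"
          unfolding m_def by (rule mult_le_mono2)
        then show ?thesis using spec[OF count, of y] S(2)[of y] by linarith
      qed (simp add: count_list_0_iff)
      then obtain h where h: "inj_on h {..<length l}"
        "\<And>i. i < length l \<Longrightarrow> fst (h i) = l ! i \<and> snd (h i) \<in> S (l ! i)"
        using distinct_copies[of S l] finS by blast
      \<comment> \<open>Vertices of the tight path are numbered from 1, list entries from 0.\<close>
      define f where "f i = prod_encode (h (i - 1))" for i
      show "monochromatic_copy c G (tight_path r n)"
      proof (rule monochromatic_copyI[where h = f and k = k])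
        have "inj_on (\<lambda>i. h (i - 1)) {1..n}"
        proof (rule inj_onI)
          fix i j assume ij: "i \<in> {1..n}" "j \<in> {1..n}" "h (i - 1) = h (j - 1)"
          then have "i - 1 = j - 1" using len by (intro inj_onD[OF h(1)]) auto
          then show "i = j" using ij by auto
        qed
        then show "inj_on f {1..n}"
          unfolding f_def using inj_on_subset[OF inj_prod_encode subset_UNIV]
          by (rule comp_inj_on[unfolded o_def])
        show "f ` {1..n} \<subseteq> verts G"
        proof (rule image_subsetI)
          fix i assume "i \<in> {1..n}"
          then have "1 \<le> i" "i \<le> n" by simp_all
          then have i: "i - 1 < length l" using len by linarith
          have "l ! (i - 1) \<in> V" using setl nth_mem[OF i] by (rule subsetD)
          moreover have "snd (h (i - 1)) \<in> {..<K}" using h(2)[OF i] S(1) by blast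
          ultimately have "h (i - 1) \<in> V \<times> {..<K}" using h(2)[OF i] by (simp add: mem_Times_iff)
          then show "f i \<in> verts G" by (simp add: f_def G_def)
        qed
        show "r \<ge> 1" by (rule r)
        fix i assume i: "1 \<le> i" "i + r \<le> Suc n"
        define w where "w = take r (drop (i - 1) l)"
        have "i - 1 + r \<le> length l" using i len by linarith
        then have "local_window V ball col k w"
          using l(1) unfolding w_def all_windows_def by blast
        then obtain z where z: "z \<in> V" "set w \<subseteq> ball z" and colw: "col (mset w) = k"
          by (auto simp: local_window_def)
        define J where "J = {i - 1..<i - 1 + r}"
        have J: "J \<subseteq> {..<length l}" using i len by (auto simp: J_def)
        have w_eq: "w = map ((!) l) [i - 1..<i - 1 + r]"
          unfolding w_def using i len by (intro nth_equalityI) auto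
        have e_eq: "f ` {i..<i + r} = prod_encode ` h ` J"
        proof -
          have "{i..<i + r} = Suc ` J" using i by (simp add: J_def)
          then show ?thesis by (simp add: f_def image_image)
        qed
        have inj: "inj_on h J" using h(1) J inj_on_subset by blast
        have cardJ: "card (h ` J) = r" using card_image[OF inj] by (simp add: J_def)
        have "image_mset fst (mset_set (h ` J)) = image_mset (\<lambda>j. fst (h j)) (mset_set J)"
          unfolding image_mset_mset_set[OF inj, symmetric] by (simp add: multiset.map_comp o_def)
        also have "\<dots> = image_mset ((!) l) (mset_set J)"
          using J h(2) by (intro image_mset_cong) (auto simp: J_def)
        also have "\<dots> = mset w" unfolding w_eq by (simp add: J_def)
        finally have ms: "image_mset fst (mset_set (h ` J)) = mset w" .
        have setw: "set w = (!) l ` J" unfolding w_eq by (simp add: J_def)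
        have sub: "h ` J \<subseteq> Sigma (ball z) S"
        proof
          fix x assume "x \<in> h ` J"
          then obtain j where j: "j \<in> J" "x = h j" by blast
          then have "fst x = l ! j" "snd x \<in> S (l ! j)" "l ! j \<in> ball z"
            using h(2)[of j] J z(2) setw by auto
          then show "x \<in> Sigma (ball z) S" by (cases x) auto
        qed
        then have "h ` J \<in> edges_at z" using cardJ S(1) by (fastforce simp: edges_at_def)
        then have edge: "f ` {i..<i + r} \<in> edges G" using z(1) e_eq by (auto simp: G_def)
        have "edge_of (mset w) (h ` J)" unfolding edge_of_def using z(1) sub cardJ ms by blast
        then have "\<chi> (h ` J) = k" using col[of "mset w" "h ` J" z] z colw by simp
        \<comment> \<open>On an edge the default in \<open>\<chi>\<close> is not taken.\<close>
        moreover have "c (f ` {i..<i + r}) < s" using c edge by blast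
        ultimately show "f ` {i..<i + r} \<in> edges G \<and> c (f ` {i..<i + r}) = k"
          using edge e_eq by (simp add: \<chi>_def)
      qed
    qed
    ultimately show ?thesis by blast
  qed
  then show ?thesis by blast
qed

theorem theorem1p1:
  fixes r s :: nat
  assumes "r \<ge> 1" and "s \<ge> 1"
  shows "\<exists>C :: nat. \<forall>n \<ge> 1. size_ramsey s (tight_path r n) \<le> enat (C * n)"
proof -
  obtain C where C: "\<forall>n\<ge>1. \<exists>G :: nat hypergraph. finite_hypergraph G \<and> arrows G s (tight_path r n) \<and>
    card (edges G) \<le> C * n"
    using tight_path_host[OF assms] by blast
  have "size_ramsey s (tight_path r n) \<le> enat (C * n)" if n: "n \<ge> 1" for n
  proof -
    obtain G :: "nat hypergraph" where G: "finite_hypergraph G" "arrows G s (tight_path r n)"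
      "card (edges G) \<le> C * n" using C n by blast
    have "size_ramsey s (tight_path r n) \<le> enat (card (edges G))"
      unfolding size_ramsey_def by (rule Inf_lower) (use G in blast)
    also have "\<dots> \<le> enat (C * n)" using G(3) by simp
    finally show ?thesis .
  qed
  then show ?thesis by blast
qed

end
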